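(* For $i,j\in\{0,1,2\}$ let $\chi_{ij}(x,y)$ denote the characteristic function of the set $[0,1/3]^2+(i/3,j/3)\subset\mathbb{R}^2$. Let $\psi_1,\dots,\psi_4$ be the functions on $\mathbb{R}^2$ given by $$\psi_1=\tfrac{\sqrt{10}}{30}\left(5\chi_{00}-\chi_{01}-4\chi_{02}-4\chi_{10}-\chi_{11}+5\chi_{12}-\chi_{20}+2\chi_{21}-\chi_{22}\right),$$ $$\psi_2=\tfrac{\sqrt{15}}{30}\left(-\chi_{01}+\chi_{02}-4\chi_{10}+4\chi_{11}+4\chi_{20}-3\chi_{21}-\chi_{22}\right),$$ $$\psi_3=\tfrac{\sqrt{15}}{30}\left(2\chi_{00}-5\chi_{01}+3\chi_{02}+2\chi_{11}-2\chi_{12}-2\chi_{20}+3\chi_{21}-\chi_{22}\right),$$ $$\psi_4=\tfrac{\sqrt{10}}{10}\left(\chi_{00}-\chi_{02}+\chi_{11}-\chi_{12}-\chi_{20}-\chi_{21}+2\chi_{22}\right).$$ Then the set $\{\psi_1,\dots,\psi_4\}$ is a bidyadic wavelet set. That is, the set $$\left\{3^{(n+m)/2}\psi_i(3^mx+k_1,3^ny+k_2):(m,n),(k_1,k_2)\in\mathbb{Z}^2,\ 1\le i\le4\right\}$$ is an orthonormal basis in $L^2(\mathbb{R}^2)$.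
   Context: All functions are considered as elements of $L^2(\mathbb{R}^2)$ with Lebesgue measure. The term "bidyadic wavelet set" means here exactly the orthonormal basis property displayed in the claim, for the commuting pair of dilation matrices $A=\mathrm{diag}(3,1)$, $B=\mathrm{diag}(1,3)$.
   Formalization: As printed, each ψ_i has L²-norm 1/3 (e.g. ‖ψ_1‖² = (10/900)·90·(1/9) = 1/9), so the displayed system is orthogonal but not orthonormal; the formal theorem proves the claim for 3ψ_1,…,3ψ_4 instead of ψ_1,…,ψ_4. *)

theory Defs
  imports "HOL-Analysis.Analysis"
begin

text \<open>Elements of \<open>L\<^sup>2(\<real>\<^sup>2)\<close> (complex scalars) are represented by functions, not by classes
  modulo almost everywhere equality.\<close>

definition L2_plane :: "(real \<times> real \<Rightarrow> complex) set" where
  "L2_plane = {f. f \<in> borel_measurable lebesgue \<and> integrable lebesgue (\<lambda>p. (cmod (f p))\<^sup>2)}"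

definition L2_inner :: "(real \<times> real \<Rightarrow> complex) \<Rightarrow> (real \<times> real \<Rightarrow> complex) \<Rightarrow> complex" where
  "L2_inner f g = (LINT p|lebesgue. f p * cnj (g p))"

definition L2_norm :: "(real \<times> real \<Rightarrow> complex) \<Rightarrow> real" where
  "L2_norm f = sqrt (LINT p|lebesgue. (cmod (f p))\<^sup>2)"

text \<open>The last conjunct says that the linear span of \<open>E\<close> is dense. Two different functions that agree
  almost everywhere count as different elements of \<open>E\<close>, so such a pair is excluded by orthogonality.\<close>

definition orthonormal_basis_L2 :: "(real \<times> real \<Rightarrow> complex) set \<Rightarrow> bool" where
  "orthonormal_basis_L2 E \<longleftrightarrow>
     E \<subseteq> L2_plane \<and>
     (\<forall>f\<in>E. \<forall>g\<in>E. L2_inner f g = (if f = g then 1 else 0)) \<and>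
     (\<forall>f\<in>L2_plane. \<forall>e>0. \<exists>T c. finite T \<and> T \<subseteq> E \<and>
        L2_norm (\<lambda>p. f p - (\<Sum>g\<in>T. c g * g p)) < e)"

definition bidyadic_system ::
  "(real \<times> real \<Rightarrow> complex) set \<Rightarrow> (real \<times> real \<Rightarrow> complex) set" where
  "bidyadic_system \<Psi> =
     {(\<lambda>(x, y). complex_of_real (3 powr (real_of_int (n + m) / 2)) *
          \<psi> (3 powi m * x + real_of_int k1, 3 powi n * y + real_of_int k2))
      | \<psi> m n k1 k2. \<psi> \<in> \<Psi>}"

definition bidyadic_wavelet_set :: "(real \<times> real \<Rightarrow> complex) set \<Rightarrow> bool" where
  "bidyadic_wavelet_set \<Psi> \<longleftrightarrow> orthonormal_basis_L2 (bidyadic_system \<Psi>)"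

definition chi :: "nat \<Rightarrow> nat \<Rightarrow> real \<times> real \<Rightarrow> complex" where
  "chi i j = indicator ((+) (real i / 3, real j / 3) ` ({0..1/3} \<times> {0..1/3}))"

definition psi1 :: "real \<times> real \<Rightarrow> complex" where
  "psi1 p = complex_of_real (sqrt 10 / 30) *
     (5 * chi 0 0 p - chi 0 1 p - 4 * chi 0 2 p
      - 4 * chi 1 0 p - chi 1 1 p + 5 * chi 1 2 p
      - chi 2 0 p + 2 * chi 2 1 p - chi 2 2 p)"

definition psi2 :: "real \<times> real \<Rightarrow> complex" where
  "psi2 p = complex_of_real (sqrt 15 / 30) *
     (- chi 0 1 p + chi 0 2 p
      - 4 * chi 1 0 p + 4 * chi 1 1 p
      + 4 * chi 2 0 p - 3 * chi 2 1 p - chi 2 2 p)"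

definition psi3 :: "real \<times> real \<Rightarrow> complex" where
  "psi3 p = complex_of_real (sqrt 15 / 30) *
     (2 * chi 0 0 p - 5 * chi 0 1 p + 3 * chi 0 2 p
      + 2 * chi 1 1 p - 2 * chi 1 2 p
      - 2 * chi 2 0 p + 3 * chi 2 1 p - chi 2 2 p)"

definition psi4 :: "real \<times> real \<Rightarrow> complex" where
  "psi4 p = complex_of_real (sqrt 10 / 10) *
     (chi 0 0 p - chi 0 2 p
      + chi 1 1 p - chi 1 2 p
      - chi 2 0 p - chi 2 1 p + 2 * chi 2 2 p)"

text \<open>The characteristic functions of the nine squares have norm \<open>1/3\<close>, and the coefficient vectors
  of the \<open>psi\<close> are orthonormal in \<open>\<real>\<^sup>9\<close>. Hence each \<open>psi\<close> has norm \<open>1/3\<close>, not \<open>1\<close>: without a further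
  factor 3 the set is not a bidyadic wavelet set.\<close>

lemma chi_altdef:
  "chi i j = indicator (cbox (real i / 3, real j / 3) (real (Suc i) / 3, real (Suc j) / 3))"
proof -
  have "(+) (real i / 3, real j / 3) ` ({0..1/3} \<times> {0..1/3})
        = (+) (real i / 3, real j / 3) ` cbox (0, 0) (1/3, 1/3 :: real)"
    by (simp add: cbox_Pair_eq)
  also have "\<dots> = cbox (real i / 3, real j / 3) (real (Suc i) / 3, real (Suc j) / 3)"
    by (subst cbox_translation[symmetric]) (simp add: add_divide_distrib add.commute)
  finally show ?thesis
    by (simp add: chi_def)
qed

lemma chi_mult:
  fixes p :: "real \<times> real"
  shows "chi i j p * chi k l p = indicator
    (cbox (real (max i k) / 3, real (max j l) / 3) (real (Suc (min i k)) / 3, real (Suc (min j l)) / 3)) p"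
  by (cases p) (auto simp: chi_altdef indicator_def cbox_Pair_eq max_def min_def)

lemma integrable_chi_mult: "integrable lebesgue (\<lambda>p. chi i j p * chi k l p)"
proof -
  have "integrable lebesgue (\<lambda>p. complex_of_real (indicator (cbox (real (max i k) / 3, real (max j l) / 3)
      (real (Suc (min i k)) / 3, real (Suc (min j l)) / 3)) p))"
    by (intro integrable_of_real integrable_real_indicator) (auto simp: emeasure_lborel_cbox_eq)
  then show ?thesis
    unfolding chi_mult by (simp only: of_real_indicator)
qed

lemma integral_chi_mult:
  "(LINT p|lebesgue. chi i j p * chi k l p) = (if i = k \<and> j = l then 1/9 else 0)"
proof -
  have "(LINT p|lebesgue. chi i j p * chi k l p) = complex_of_real (measure lebesgue
    (cbox (real (max i k) / 3, real (max j l) / 3) (real (Suc (min i k)) / 3, real (Suc (min j l)) / 3)))"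
    unfolding chi_mult
    by (subst of_real_indicator[symmetric], subst integral_complex_of_real) simp
  also have "\<dots> = (if i = k \<and> j = l then 1/9 else 0)"
  proof (cases "i = k \<and> j = l")
    case True
    then show ?thesis by (simp add: content_Pair diff_divide_distrib[symmetric])
  next
    case False
    have "measure lebesgue (cbox (real (max a b) / 3) (real (Suc (min a b)) / 3)) = 0"
      if "a \<noteq> b" for a b :: nat
      using that by (auto simp: max_def min_def)
    with False show ?thesis by (auto simp: content_Pair)
  qed
  finally show ?thesis .
qed

lemma integral_chi_combination:
  fixes a :: "nat \<Rightarrow> nat \<Rightarrow> complex"
  assumes "\<And>p. h p = (\<Sum>(i, j)\<in>{..<3}\<times>{..<3}. a i j * chi i j p)"
  shows "(LINT p|lebesgue. h p * h p) = (\<Sum>(i, j)\<in>{..<3}\<times>{..<3}. (a i j)\<^sup>2 / 9)"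
proof -
  let ?I = "{..<3::nat} \<times> {..<3::nat}"
  have "h p * h p = (\<Sum>q\<in>?I. \<Sum>r\<in>?I. (a (fst q) (snd q) * a (fst r) (snd r)) *
      (chi (fst q) (snd q) p * chi (fst r) (snd r) p))" for p
    by (simp add: assms sum_product case_prod_unfold mult_ac)
  then have "(LINT p|lebesgue. h p * h p) =
      (\<Sum>q\<in>?I. \<Sum>r\<in>?I. (a (fst q) (snd q) * a (fst r) (snd r)) *
        (LINT p|lebesgue. chi (fst q) (snd q) p * chi (fst r) (snd r) p))"
    by (simp add: integral_sum integrable_sum integrable_chi_mult)
  also have "\<dots> = (\<Sum>q\<in>?I. \<Sum>r\<in>?I. if q = r then (a (fst q) (snd q))\<^sup>2 / 9 else 0)"
    by (intro sum.cong refl) (auto simp: integral_chi_mult power2_eq_square prod_eq_iff)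
  also have "\<dots> = (\<Sum>(i, j)\<in>?I. (a i j)\<^sup>2 / 9)"
    by (simp add: case_prod_unfold)
  finally show ?thesis .
qed

lemma L2_inner_psi1: "L2_inner psi1 psi1 = 1/9"
proof -
  have cnj_chi: "cnj (chi i j p) = chi i j p" for i j p
    by (simp add: chi_def indicator_def)
  define h :: "real \<times> real \<Rightarrow> complex" where
    "h p = 5 * chi 0 0 p - chi 0 1 p - 4 * chi 0 2 p - 4 * chi 1 0 p - chi 1 1 p + 5 * chi 1 2 p
      - chi 2 0 p + 2 * chi 2 1 p - chi 2 2 p" for p
  have "cnj (h p) = h p" for p
    by (simp add: h_def cnj_chi)
  moreover have "psi1 p = complex_of_real (sqrt 10 / 30) * h p" for p
    by (simp only: psi1_def h_def)
  ultimately have "psi1 p * cnj (psi1 p) = complex_of_real ((sqrt 10 / 30)\<^sup>2) * (h p * h p)" for p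
    by (simp only: complex_cnj_mult complex_cnj_complex_of_real power2_eq_square of_real_mult mult_ac)
  then have "L2_inner psi1 psi1 = complex_of_real ((sqrt 10 / 30)\<^sup>2) * (LINT p|lebesgue. h p * h p)"
    unfolding L2_inner_def by simp
  also have "(LINT p|lebesgue. h p * h p) = 10"
    by (subst integral_chi_combination[where
          a = "\<lambda>i j. [[5, -1, -4], [-4, -1, 5], [-1, 2, -1]] ! i ! j"])
      (simp_all add: h_def sum.cartesian_product[symmetric] numeral_3_eq_3 numeral_2_eq_2)
  finally show ?thesis
    by (simp add: power_divide)
qed

lemma not_bidyadic_wavelet_set_unscaled: "\<not> bidyadic_wavelet_set {psi1, psi2, psi3, psi4}"
proof
  assume "bidyadic_wavelet_set {psi1, psi2, psi3, psi4}"
  moreover have "psi1 \<in> bidyadic_system {psi1, psi2, psi3, psi4}"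
    unfolding bidyadic_system_def
    by (intro CollectI exI[of _ psi1] exI[of _ "0::int"]) (auto simp: fun_eq_iff)
  ultimately have "L2_inner psi1 psi1 = 1"
    unfolding bidyadic_wavelet_set_def orthonormal_basis_L2_def by auto
  then show False
    by (simp add: L2_inner_psi1)
qed

end

theory Submission
  imports Defs
begin

text \<open>Off the lines with a rational coordinate, the functions of the system are combinations of
  products of indicators of half-open triadic intervals. The four coefficient matrices are, up to
  normalisation, an orthonormal basis of the \<open>3\<times>3\<close> matrices with vanishing row and column
  sums. Vanishing sums give orthogonality across different scales, since a triadic interval meets all
  children of a finer interval in the same way; orthonormality of the matrices takes care of equal
  scales. For density, the matrices span all products of one-dimensional details
  \<open>1\<^sub>I - 1/3 1\<^sub>J\<close> with \<open>J\<close> the parent of \<open>I\<close>.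
  Telescoping towards coarser scales yields all triadic rectangles, and a Dynkin system argument with
  triadic squares then yields all of \<open>L\<^sup>2\<close>.\<close>

section \<open>Triadic intervals on the line and their products in the plane\<close>

definition triadic :: "int \<Rightarrow> int \<Rightarrow> real \<Rightarrow> complex" where
  "triadic m k x = of_bool (\<lfloor>3 powi m * x\<rfloor> = k)"

text \<open>Dividing an index by \<open>3 ^ j\<close> gives the index of the ancestor interval
  \<open>j\<close> levels up. All nesting of triadic intervals, at negative scales too, reduces to
  this arithmetic.\<close>

lemma floor_triadic_div: "\<lfloor>3 powi (m - int j) * x\<rfloor> = \<lfloor>3 powi m * x\<rfloor> div 3 ^ j" for x :: real
proof -
  have "3 powi (m - int j) * x = 3 powi m * x / real_of_int (3 ^ j)"
    by (simp add: power_int_diff)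
  then show ?thesis
    by (metis floor_divide_real_eq_div zero_le_numeral zero_le_power)
qed

text \<open>Two triadic intervals are nested or disjoint, and the ancestor test on indices decides
  which.\<close>

lemma triadic_mult:
  assumes "m \<le> m'"
  shows "triadic m k x * triadic m' k' x = of_bool (k' div 3 ^ nat (m' - m) = k) * triadic m' k' x"
  using floor_triadic_div[of m' "nat (m' - m)" x] assms by (auto simp: triadic_def)

lemma triadic_refine:
  "triadic m k x = (\<Sum>a<3. triadic (m + 1) (3 * k + int a) x)"
proof -
  have "\<lfloor>3 powi m * x\<rfloor> = \<lfloor>3 powi (m + 1) * x\<rfloor> div 3"
    using floor_triadic_div[of "m + 1" 1 x] by simp
  then have "\<lfloor>3 powi m * x\<rfloor> = k \<longleftrightarrow>
      \<lfloor>3 powi (m + 1) * x\<rfloor> = 3 * k \<or> \<lfloor>3 powi (m + 1) * x\<rfloor> = 3 * k + 1 \<or> \<lfloor>3 powi (m + 1) * x\<rfloor> = 3 * k + 2"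
    by presburger
  then show ?thesis
    by (auto simp: triadic_def numeral_3_eq_3)
qed

lemma cnj_triadic [simp]: "cnj (triadic m k x) = triadic m k x"
  by (simp add: triadic_def)

lemma triadic_borel [measurable]: "triadic m k \<in> borel_measurable borel"
  unfolding triadic_def by measurable

lemma triadic_eq_indicator:
  "triadic m k x = indicator {of_int k / 3 powi m ..< (of_int k + 1) / 3 powi m} x"
proof -
  have "(0::real) < 3 powi m" by (simp add: zero_less_power_int)
  then show ?thesis
    by (auto simp: triadic_def indicator_def floor_eq_iff field_simps)
qed

lemma borel_measurable_lebesgueI: "f \<in> borel_measurable borel \<Longrightarrow> f \<in> borel_measurable lebesgue"
  by (auto intro: measurable_completion)

lemma has_integral_triadic:
  shows integrable_triadic: "integrable lebesgue (\<lambda>p. triadic m k (fst p) * triadic n l (snd p))"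
    and integral_triadic: "(LINT p|lebesgue. triadic m k (fst p) * triadic n l (snd p)) =
       of_real (3 powi (- m) * 3 powi (- n))"
proof -
  define I where "I m k = {of_int k / 3 powi m ..< (of_int k + 1) / (3 powi m :: real)}" for m k :: int
  have pos: "(0::real) < 3 powi m" for m by (simp add: zero_less_power_int)
  have eq: "triadic m k (fst p) * triadic n l (snd p) = of_real (indicator (I m k \<times> I n l) p)" for p
    by (cases p) (simp add: triadic_eq_indicator I_def indicator_times of_real_indicator)
  have em1: "emeasure lborel (I m k) = ennreal (3 powi (- m))" for m k
    using pos[of m] unfolding I_def
    by (subst emeasure_lborel_Ico) (auto simp: field_simps power_int_minus)
  have meas: "I m k \<times> I n l \<in> sets borel"
    by (simp add: I_def borel_Times)
  then have meas': "I m k \<times> I n l \<in> sets lborel" by simp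
  have "emeasure lborel (I m k \<times> I n l) = emeasure lborel (I m k) * emeasure lborel (I n l)"
    unfolding lborel_prod[symmetric]
    by (rule lborel.emeasure_pair_measure_Times) (auto simp: I_def)
  also have "\<dots> = ennreal (3 powi (- m) * 3 powi (- n))"
    using pos by (simp add: em1 ennreal_mult less_imp_le)
  finally have em: "emeasure lebesgue (I m k \<times> I n l) = ennreal (3 powi (- m) * 3 powi (- n))"
    using meas' by simp
  show "integrable lebesgue (\<lambda>p. triadic m k (fst p) * triadic n l (snd p))"
    unfolding eq using meas em
    by (intro integrable_of_real integrable_real_indicator) auto
  show "(LINT p|lebesgue. triadic m k (fst p) * triadic n l (snd p)) = of_real (3 powi (- m) * 3 powi (- n))"
    unfolding eq using em pos
    by (simp add: measure_def less_imp_le)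
qed

lemma triadic_tensor_measurable [measurable]:
  "(\<lambda>p. triadic m k (fst p) * triadic n l (snd p)) \<in> borel_measurable lebesgue"
  by (rule borel_measurable_lebesgueI, unfold borel_prod[symmetric]) measurable

text \<open>This is the inner product of two triadic indicators on the line: the length of the finer
  interval if the coarser one contains it, and 0 otherwise.\<close>

definition triadic_inner :: "int \<Rightarrow> int \<Rightarrow> int \<Rightarrow> int \<Rightarrow> real" where
  "triadic_inner m k m' k' =
     (if m \<le> m' then of_bool (k' div 3 ^ nat (m' - m) = k) * 3 powi (- m')
      else of_bool (k div 3 ^ nat (m - m') = k') * 3 powi (- m))"

text \<open>Hiding the order of the scales behind an existential lets the two coordinates be treated
  independently: a product of two tensors becomes a multiple of a single tensor, whose integral is
  known.\<close>

lemma triadic_mult_cases: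
  "\<exists>c M K. (\<forall>x. triadic m k x * triadic m' k' x = c * triadic M K x) \<and>
     of_real (triadic_inner m k m' k') = c * of_real (3 powi (- M))"
proof (cases "m \<le> m'")
  case True
  then show ?thesis
    by (intro exI[of _ "of_bool (k' div 3 ^ nat (m' - m) = k)"] exI[of _ m'] exI[of _ k'])
      (simp add: triadic_mult triadic_inner_def)
next
  case False
  then show ?thesis
    by (intro exI[of _ "of_bool (k div 3 ^ nat (m - m') = k')"] exI[of _ m] exI[of _ k])
      (simp add: triadic_mult triadic_inner_def mult.commute[of "triadic m k _"])
qed

lemma triadic_tensor_inner:
  shows integrable_triadic_tensor_mult:
    "integrable lebesgue (\<lambda>p. (triadic m k (fst p) * triadic n l (snd p)) *
       (triadic m' k' (fst p) * triadic n' l' (snd p)))"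
    and integral_triadic_tensor_mult:
    "(LINT p|lebesgue. (triadic m k (fst p) * triadic n l (snd p)) *
       (triadic m' k' (fst p) * triadic n' l' (snd p))) =
     of_real (triadic_inner m k m' k' * triadic_inner n l n' l')"
proof -
  obtain c M K where 1: "\<And>x. triadic m k x * triadic m' k' x = c * triadic M K x"
     "of_real (triadic_inner m k m' k') = c * of_real (3 powi (- M))"
    using triadic_mult_cases by metis
  obtain d N L where 2: "\<And>x. triadic n l x * triadic n' l' x = d * triadic N L x"
     "of_real (triadic_inner n l n' l') = d * of_real (3 powi (- N))"
    using triadic_mult_cases by metis
  have eq: "(triadic m k (fst p) * triadic n l (snd p)) * (triadic m' k' (fst p) * triadic n' l' (snd p))
     = (c * d) * (triadic M K (fst p) * triadic N L (snd p))" for p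
  proof -
    have "(triadic m k (fst p) * triadic n l (snd p)) * (triadic m' k' (fst p) * triadic n' l' (snd p))
      = (triadic m k (fst p) * triadic m' k' (fst p)) * (triadic n l (snd p) * triadic n' l' (snd p))"
      by (simp only: mult_ac)
    then show ?thesis by (simp only: 1 2 mult_ac)
  qed
  show "integrable lebesgue (\<lambda>p. (triadic m k (fst p) * triadic n l (snd p)) *
       (triadic m' k' (fst p) * triadic n' l' (snd p)))"
    unfolding eq by (intro integrable_mult_right integrable_triadic)
  show "(LINT p|lebesgue. (triadic m k (fst p) * triadic n l (snd p)) *
       (triadic m' k' (fst p) * triadic n' l' (snd p))) =
     of_real (triadic_inner m k m' k' * triadic_inner n l n' l')"
    unfolding eq integral_mult_right_zero integral_triadic of_real_mult 1 2 by (simp only: mult_ac)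
qed

lemma triadic_inner_same: "triadic_inner m k m k' = of_bool (k = k') * 3 powi (- m)"
  by (auto simp: triadic_inner_def)

text \<open>The three children of an interval share their ancestor at every strictly coarser scale.
  This lets vanishing coefficient sums annihilate inner products across scales.\<close>

lemma triadic_inner_finer:
  assumes "m < m'" "a < 3"
  shows "triadic_inner m k m' (3 * k' + int a) = triadic_inner m k m' (3 * k')"
proof -
  obtain j where j: "nat (m' - m) = Suc j"
    using assms(1) by (metis Suc_pred' diff_gt_0_iff_gt zero_less_nat_eq)
  have "(3 * k' + int a) div 3 = k'"
    using assms(2) by auto
  then have "(3 * k' + int a) div 3 ^ Suc j = (3 * k') div 3 ^ Suc j"
    by (simp add: zdiv_zmult2_eq)
  then show ?thesis
    using assms(1) by (simp add: triadic_inner_def j)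
qed


section \<open>Closed spans in the space of square integrable functions\<close>

text \<open>Squared norms keep square roots out of the estimates; the root returns only in the final
  density claim, through the tolerance \<open>e\<^sup>2\<close>.\<close>

definition L2_sq :: "(real \<times> real \<Rightarrow> complex) \<Rightarrow> real" where
  "L2_sq f = (LINT p|lebesgue. (cmod (f p))\<^sup>2)"

lemma L2_planeD:
  assumes "f \<in> L2_plane"
  shows L2_plane_measurable: "f \<in> borel_measurable lebesgue"
    and L2_plane_integrable: "integrable lebesgue (\<lambda>p. (cmod (f p))\<^sup>2)"
  using assms by (auto simp: L2_plane_def)

lemma L2_sq_nonneg: "L2_sq f \<ge> 0"
  by (simp add: L2_sq_def)

text \<open>This stands in for the triangle inequality of the norm. The extra factor 2 is harmless
  where only smallness or integrability matters.\<close>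

lemma cmod_add_sq_le: "(cmod (a + b))\<^sup>2 \<le> 2 * (cmod a)\<^sup>2 + 2 * (cmod b)\<^sup>2"
proof -
  have "(cmod (a + b))\<^sup>2 \<le> (cmod a + cmod b)\<^sup>2"
    by (intro power_mono norm_triangle_ineq) simp
  also have "\<dots> \<le> 2 * (cmod a)\<^sup>2 + 2 * (cmod b)\<^sup>2"
    using zero_le_power2[of "cmod a - cmod b"] by (simp add: power2_eq_square algebra_simps)
  finally show ?thesis .
qed

lemma L2_plane_dominated:
  assumes "f \<in> borel_measurable lebesgue" "integrable lebesgue w" "\<And>p. (cmod (f p))\<^sup>2 \<le> w p"
  shows "f \<in> L2_plane"
proof -
  have "integrable lebesgue (\<lambda>p. (cmod (f p))\<^sup>2)"
    by (rule Bochner_Integration.integrable_bound[OF assms(2)])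
      (use assms in \<open>auto intro!: AE_I2 intro: order_trans[OF _ abs_ge_self]\<close>)
  with assms(1) show ?thesis by (simp add: L2_plane_def)
qed

lemma L2_plane_scale:
  assumes "f \<in> L2_plane"
  shows "(\<lambda>p. c * f p) \<in> L2_plane"
  using assms
  by (auto simp: L2_plane_def norm_mult power_mult_distrib intro: borel_measurable_times borel_measurable_const)

lemma L2_sq_scale: "L2_sq (\<lambda>p. c * f p) = (cmod c)\<^sup>2 * L2_sq f"
  by (simp add: L2_sq_def norm_mult power_mult_distrib)

lemma L2_add:
  assumes "f \<in> L2_plane" "g \<in> L2_plane"
  shows L2_plane_add: "(\<lambda>p. f p + g p) \<in> L2_plane"
    and L2_sq_add_le: "L2_sq (\<lambda>p. f p + g p) \<le> 2 * L2_sq f + 2 * L2_sq g"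
proof -
  note [measurable] = L2_plane_measurable[OF assms(1)] L2_plane_measurable[OF assms(2)]
  note int = L2_plane_integrable[OF assms(1)] L2_plane_integrable[OF assms(2)]
  show *: "(\<lambda>p. f p + g p) \<in> L2_plane"
    by (rule L2_plane_dominated[where w = "\<lambda>p. 2 * (cmod (f p))\<^sup>2 + 2 * (cmod (g p))\<^sup>2"])
      (use int cmod_add_sq_le in auto)
  have "L2_sq (\<lambda>p. f p + g p) \<le> (LINT p|lebesgue. 2 * (cmod (f p))\<^sup>2 + 2 * (cmod (g p))\<^sup>2)"
    unfolding L2_sq_def
    by (rule integral_mono) (use int cmod_add_sq_le L2_plane_integrable[OF *] in auto)
  also have "\<dots> = 2 * L2_sq f + 2 * L2_sq g"
    using int by (simp add: L2_sq_def)
  finally show "L2_sq (\<lambda>p. f p + g p) \<le> 2 * L2_sq f + 2 * L2_sq g" .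
qed

lemma L2_plane_diff:
  assumes "f \<in> L2_plane" "g \<in> L2_plane"
  shows "(\<lambda>p. f p - g p) \<in> L2_plane"
  using L2_plane_add[OF assms(1) L2_plane_scale[OF assms(2), of "-1"]] by simp

lemma L2_sq_diff_le:
  assumes "f \<in> L2_plane" "g \<in> L2_plane"
  shows "L2_sq (\<lambda>p. f p - g p) \<le> 2 * L2_sq f + 2 * L2_sq g"
  using L2_sq_add_le[OF assms(1) L2_plane_scale[OF assms(2), of "-1"]]
  unfolding L2_sq_scale by simp

lemma L2_plane_zero: "(\<lambda>p. 0) \<in> L2_plane"
  by (simp add: L2_plane_def)

lemma L2_plane_sum:
  assumes "\<And>i. i \<in> I \<Longrightarrow> f i \<in> L2_plane"
  shows "(\<lambda>p. \<Sum>i\<in>I. f i p) \<in> L2_plane"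
  using assms by (induction I rule: infinite_finite_induct) (auto intro: L2_plane_zero L2_plane_add)

lemma L2_plane_AE:
  assumes "f \<in> L2_plane" "g \<in> borel_measurable lebesgue" "AE p in lebesgue. f p = g p"
  shows "g \<in> L2_plane"
proof -
  note [measurable] = L2_plane_measurable[OF assms(1)] assms(2)
  have "integrable lebesgue (\<lambda>p. (cmod (g p))\<^sup>2)"
    by (rule integrable_cong_AE_imp[OF L2_plane_integrable[OF assms(1)]]) (use assms(3) in auto)
  with assms show ?thesis by (simp add: L2_plane_def)
qed

lemma borel_measurable_cnj:
  assumes "f \<in> borel_measurable M"
  shows "(\<lambda>x. cnj (f x)) \<in> borel_measurable M"
  by (rule measurable_compose[OF assms]) (intro borel_measurable_continuous_onI continuous_intros)

lemma L2_inner_AE: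
  assumes "f \<in> borel_measurable lebesgue" "f' \<in> borel_measurable lebesgue" "AE p in lebesgue. f p = f' p"
    and "g \<in> borel_measurable lebesgue" "g' \<in> borel_measurable lebesgue" "AE p in lebesgue. g p = g' p"
  shows "L2_inner f g = L2_inner f' g'"
proof -
  note [measurable] = assms(1,2,4,5)
  show ?thesis
    unfolding L2_inner_def by (rule integral_cong_AE) (use assms(3,6) in \<open>auto intro!: borel_measurable_times borel_measurable_cnj assms\<close>)
qed

text \<open>This is the density clause of \<open>orthonormal_basis_L2\<close> read as a property of
  one function, so that density becomes \<open>closed_span E = L2_plane\<close>.\<close>

definition closed_span :: "(real \<times> real \<Rightarrow> complex) set \<Rightarrow> (real \<times> real \<Rightarrow> complex) set" where
  "closed_span E = {f \<in> L2_plane. \<forall>e>0. \<exists>T c. finite T \<and> T \<subseteq> E \<and>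
     L2_sq (\<lambda>p. f p - (\<Sum>g\<in>T. c g * g p)) < e}"

lemma closed_span_subset: "closed_span E \<subseteq> L2_plane"
  by (auto simp: closed_span_def)

lemma closed_spanD:
  assumes "f \<in> closed_span E" "e > 0"
  obtains T c where "finite T" "T \<subseteq> E" "L2_sq (\<lambda>p. f p - (\<Sum>g\<in>T. c g * g p)) < e"
  using assms by (auto simp: closed_span_def)

lemma L2_plane_comb:
  assumes "E \<subseteq> L2_plane" "T \<subseteq> E"
  shows "(\<lambda>p. \<Sum>g\<in>T. c g * g p) \<in> L2_plane"
  by (intro L2_plane_sum L2_plane_scale) (use assms in auto)

text \<open>The closed span is closed in norm. Tolerance \<open>e / 4\<close> at each of the two
  approximation stages absorbs the factor 2 of \<open>L2_sq_add_le\<close>.\<close>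

lemma closed_span_limit:
  assumes "E \<subseteq> L2_plane" "f \<in> L2_plane"
    and approx: "\<And>e. e > 0 \<Longrightarrow> \<exists>h\<in>closed_span E. L2_sq (\<lambda>p. f p - h p) < e"
  shows "f \<in> closed_span E"
  unfolding closed_span_def
proof (intro CollectI conjI allI impI assms(2))
  fix e :: real assume "e > 0"
  then obtain h where h: "h \<in> closed_span E" "L2_sq (\<lambda>p. f p - h p) < e / 4"
    using approx[of "e / 4"] by auto
  obtain T c where T: "finite T" "T \<subseteq> E" "L2_sq (\<lambda>p. h p - (\<Sum>g\<in>T. c g * g p)) < e / 4"
    using closed_spanD[OF h(1), of "e / 4"] \<open>e > 0\<close> by auto
  have hL: "h \<in> L2_plane" using h(1) closed_span_subset by auto
  have "L2_sq (\<lambda>p. (f p - h p) + (h p - (\<Sum>g\<in>T. c g * g p))) \<le>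
      2 * L2_sq (\<lambda>p. f p - h p) + 2 * L2_sq (\<lambda>p. h p - (\<Sum>g\<in>T. c g * g p))"
    by (intro L2_sq_add_le L2_plane_diff L2_plane_comb[OF assms(1)] assms(2) hL T)
  also have "\<dots> < e" using h(2) T(3) by simp
  finally show "\<exists>T c. finite T \<and> T \<subseteq> E \<and> L2_sq (\<lambda>p. f p - (\<Sum>g\<in>T. c g * g p)) < e"
    using T by auto
qed

lemma closed_span_base:
  assumes "E \<subseteq> L2_plane" "f \<in> E"
  shows "f \<in> closed_span E"
  unfolding closed_span_def
proof (intro CollectI conjI allI impI)
  show "f \<in> L2_plane" using assms by auto
  show "\<exists>T c. finite T \<and> T \<subseteq> E \<and> L2_sq (\<lambda>p. f p - (\<Sum>g\<in>T. c g * g p)) < e" if "e > 0" for e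
    using that assms by (intro exI[of _ "{f}"] exI[of _ "\<lambda>_. 1"]) (simp add: L2_sq_def)
qed

lemma closed_span_scale:
  assumes "E \<subseteq> L2_plane" "f \<in> closed_span E"
  shows "(\<lambda>p. a * f p) \<in> closed_span E"
proof -
  have fL: "f \<in> L2_plane" using assms(2) closed_span_subset by auto
  show ?thesis
    unfolding closed_span_def
  proof (intro CollectI conjI allI impI L2_plane_scale fL)
    fix e :: real assume "e > 0"
    \<comment> \<open>The added 1 keeps the tolerance positive when \<open>a = 0\<close>.\<close>
    have pos: "(cmod a)\<^sup>2 + 1 > 0" by (smt (verit) zero_le_power2)
    obtain T c where T: "finite T" "T \<subseteq> E" "L2_sq (\<lambda>p. f p - (\<Sum>g\<in>T. c g * g p)) < e / ((cmod a)\<^sup>2 + 1)"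
      using closed_spanD[OF assms(2), of "e / ((cmod a)\<^sup>2 + 1)"] \<open>e > 0\<close> pos by (auto simp del: less_divide_eq)
    have "(\<lambda>p. a * f p - (\<Sum>g\<in>T. (a * c g) * g p)) = (\<lambda>p. a * (f p - (\<Sum>g\<in>T. c g * g p)))"
      by (simp add: right_diff_distrib sum_distrib_left mult.assoc)
    then have "L2_sq (\<lambda>p. a * f p - (\<Sum>g\<in>T. (a * c g) * g p)) = (cmod a)\<^sup>2 * L2_sq (\<lambda>p. f p - (\<Sum>g\<in>T. c g * g p))"
      by (simp add: L2_sq_scale)
    also have "\<dots> \<le> ((cmod a)\<^sup>2 + 1) * L2_sq (\<lambda>p. f p - (\<Sum>g\<in>T. c g * g p))"
      by (intro mult_right_mono L2_sq_nonneg) simp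
    also have "\<dots> < e" using T(3) pos by (simp add: pos_less_divide_eq mult.commute)
    finally show "\<exists>T c. finite T \<and> T \<subseteq> E \<and> L2_sq (\<lambda>p. a * f p - (\<Sum>g\<in>T. c g * g p)) < e"
      using T by (intro exI[of _ T] exI[of _ "\<lambda>g. a * c g"]) simp
  qed
qed

lemma closed_span_add:
  assumes "E \<subseteq> L2_plane" "f \<in> closed_span E" "h \<in> closed_span E"
  shows "(\<lambda>p. f p + h p) \<in> closed_span E"
proof -
  have fL: "f \<in> L2_plane" "h \<in> L2_plane" using assms(2,3) closed_span_subset by auto
  show ?thesis
    unfolding closed_span_def
  proof (intro CollectI conjI allI impI L2_plane_add fL)
    fix e :: real assume "e > 0"
    then have e: "e / 4 > 0" by simp
    obtain T c where T: "finite T" "T \<subseteq> E" "L2_sq (\<lambda>p. f p - (\<Sum>g\<in>T. c g * g p)) < e / 4"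
      using closed_spanD[OF assms(2) e] by blast
    obtain U d where U: "finite U" "U \<subseteq> E" "L2_sq (\<lambda>p. h p - (\<Sum>g\<in>U. d g * g p)) < e / 4"
      using closed_spanD[OF assms(3) e] by blast
    \<comment> \<open>\<open>T\<close> and \<open>U\<close> may overlap, and a common element must
      receive both coefficients.\<close>
    define b where "b g = (if g \<in> T then c g else 0) + (if g \<in> U then d g else 0)" for g
    have "(\<Sum>g\<in>T \<union> U. b g * g p) = (\<Sum>g\<in>T. c g * g p) + (\<Sum>g\<in>U. d g * g p)" for p
    proof -
      have "(\<Sum>g\<in>T \<union> U. b g * g p) =
          (\<Sum>g\<in>T \<union> U. (if g \<in> T then c g * g p else 0)) + (\<Sum>g\<in>T \<union> U. (if g \<in> U then d g * g p else 0))"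
        by (simp add: b_def distrib_right sum.distrib if_distrib[of "\<lambda>x. x * _"] cong: if_cong)
      also have "(\<Sum>g\<in>T \<union> U. (if g \<in> T then c g * g p else 0)) = (\<Sum>g\<in>T. c g * g p)"
        by (rule sum.mono_neutral_cong_right) (use T U in auto)
      also have "(\<Sum>g\<in>T \<union> U. (if g \<in> U then d g * g p else 0)) = (\<Sum>g\<in>U. d g * g p)"
        by (rule sum.mono_neutral_cong_right) (use T U in auto)
      finally show ?thesis .
    qed
    then have "L2_sq (\<lambda>p. f p + h p - (\<Sum>g\<in>T \<union> U. b g * g p)) =
        L2_sq (\<lambda>p. (f p - (\<Sum>g\<in>T. c g * g p)) + (h p - (\<Sum>g\<in>U. d g * g p)))"
      by (simp add: algebra_simps)
    also have "\<dots> \<le> 2 * L2_sq (\<lambda>p. f p - (\<Sum>g\<in>T. c g * g p)) + 2 * L2_sq (\<lambda>p. h p - (\<Sum>g\<in>U. d g * g p))"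
      by (intro L2_sq_add_le L2_plane_diff L2_plane_comb[OF assms(1)] fL T U)
    also have "\<dots> < e" using T(3) U(3) by simp
    finally show "\<exists>T c. finite T \<and> T \<subseteq> E \<and> L2_sq (\<lambda>p. f p + h p - (\<Sum>g\<in>T. c g * g p)) < e"
      using T U by (intro exI[of _ "T \<union> U"] exI[of _ b]) simp
  qed
qed

lemma closed_span_zero: "(\<lambda>p. 0) \<in> closed_span E"
  unfolding closed_span_def
  by (intro CollectI conjI allI impI L2_plane_zero exI[of _ "{}"]) (simp add: L2_sq_def)

lemma closed_span_sum:
  assumes "E \<subseteq> L2_plane" "\<And>i. i \<in> I \<Longrightarrow> f i \<in> closed_span E"
  shows "(\<lambda>p. \<Sum>i\<in>I. f i p) \<in> closed_span E"
  using assms(2)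
proof (induction I rule: infinite_finite_induct)
  case (insert i I)
  then show ?case
    using closed_span_add[OF assms(1), of "f i" "\<lambda>p. \<Sum>i\<in>I. f i p"] by simp
qed (simp_all add: closed_span_zero)

lemma closed_span_diff:
  assumes "E \<subseteq> L2_plane" "f \<in> closed_span E" "h \<in> closed_span E"
  shows "(\<lambda>p. f p - h p) \<in> closed_span E"
  using closed_span_add[OF assms(1,2) closed_span_scale[OF assms(1,3), of "-1"]] by simp

lemma closed_span_AE:
  assumes "E \<subseteq> L2_plane" "f \<in> closed_span E" "g \<in> borel_measurable lebesgue" "AE p in lebesgue. f p = g p"
  shows "g \<in> closed_span E"
proof (rule closed_span_limit[OF assms(1)])
  have fL: "f \<in> L2_plane" using assms(2) closed_span_subset by auto
  then show gL: "g \<in> L2_plane" by (rule L2_plane_AE[OF _ assms(3,4)])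
  note [measurable] = L2_plane_measurable[OF fL] assms(3)
  have "L2_sq (\<lambda>p. g p - f p) = (LINT p::real \<times> real|lebesgue. 0)"
    unfolding L2_sq_def by (rule integral_cong_AE) (use assms(4) in auto)
  then show "\<exists>h\<in>closed_span E. L2_sq (\<lambda>p. g p - h p) < e" if "e > 0" for e
    using that assms(2) by (intro bexI[of _ f]) auto
qed

text \<open>The squares of \<open>f\<close> and of every \<open>s i\<close> lie below
  \<open>w\<close>, so those of the differences lie below \<open>4 * w\<close>, and dominated
  convergence turns pointwise limits into limits in norm.\<close>

lemma closed_span_dominated:
  assumes E: "E \<subseteq> L2_plane" and s: "\<And>i. s i \<in> closed_span E"
    and f: "f \<in> borel_measurable lebesgue" and w: "integrable lebesgue w"
    and lim: "\<And>p. (\<lambda>i. s i p) \<longlonglongrightarrow> f p" and bound: "\<And>i p. (cmod (s i p))\<^sup>2 \<le> w p"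
  shows "f \<in> closed_span E"
proof (rule closed_span_limit[OF E])
  have sL: "s i \<in> L2_plane" for i using s closed_span_subset by auto
  have fb: "(cmod (f p))\<^sup>2 \<le> w p" for p
    by (rule LIMSEQ_le_const2[OF tendsto_power[OF tendsto_norm[OF lim]]]) (use bound in auto)
  show fL: "f \<in> L2_plane"
    by (rule L2_plane_dominated[OF f w fb])
  note [measurable] = L2_plane_measurable[OF sL] f
  have "(\<lambda>i. L2_sq (\<lambda>p. f p - s i p)) \<longlonglongrightarrow> (LINT p::real \<times> real|lebesgue. 0)"
    unfolding L2_sq_def
  proof (rule integral_dominated_convergence[where w = "\<lambda>p. 4 * w p"])
    show "AE p in lebesgue. (\<lambda>i. (cmod (f p - s i p))\<^sup>2) \<longlonglongrightarrow> 0"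
    proof (rule AE_I2)
      fix p
      have "(\<lambda>i. (cmod (f p - s i p))\<^sup>2) \<longlonglongrightarrow> (cmod (f p - f p))\<^sup>2"
        by (intro tendsto_intros lim)
      then show "(\<lambda>i. (cmod (f p - s i p))\<^sup>2) \<longlonglongrightarrow> 0" by simp
    qed
    show "AE p in lebesgue. norm ((cmod (f p - s i p))\<^sup>2) \<le> 4 * w p" for i
    proof (rule AE_I2)
      fix p
      show "norm ((cmod (f p - s i p))\<^sup>2) \<le> 4 * w p"
        using cmod_add_sq_le[of "f p" "- s i p"] fb[of p] bound[of i p] by simp
    qed
  qed (use w in auto)
  then have lim0: "(\<lambda>i. L2_sq (\<lambda>p. f p - s i p)) \<longlonglongrightarrow> 0" by simp
  show "\<exists>h\<in>closed_span E. L2_sq (\<lambda>p. f p - h p) < e" if "e > 0" for e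
  proof -
    have "eventually (\<lambda>i. L2_sq (\<lambda>p. f p - s i p) < e) sequentially"
      by (rule order_tendstoD(2)[OF lim0 that])
    then obtain i where "L2_sq (\<lambda>p. f p - s i p) < e"
      using eventually_happens'[OF sequentially_bot] by blast
    with s show ?thesis by blast
  qed
qed

text \<open>The weighted steps sum to \<open>F 0\<close> minus the remainder
  \<open>(1/3) ^ j * F j\<close>. Squaring gives a factor \<open>1 / 9 ^ j\<close>, which beats the
  growth \<open>3 ^ j\<close> of \<open>L2_sq (F j)\<close>.\<close>

lemma closed_span_telescope:
  assumes E: "E \<subseteq> L2_plane"
    and F: "\<And>j. F j \<in> L2_plane"
    and step: "\<And>j. (\<lambda>p. F j p - 1/3 * F (Suc j) p) \<in> closed_span E"
    and bound: "\<And>j. L2_sq (F j) \<le> B * 3 ^ j"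
  shows "F 0 \<in> closed_span E"
proof (rule closed_span_limit[OF E F])
  have tele: "(\<lambda>p. F 0 p - (1/3) ^ j * F j p) \<in> closed_span E" for j
  proof (induction j)
    case 0
    show ?case by (simp add: closed_span_zero)
  next
    case (Suc j)
    have "F 0 p - (1/3) ^ j * F j p + (1/3) ^ j * (F j p - 1/3 * F (Suc j) p) =
        F 0 p - (1/3) ^ Suc j * F (Suc j) p" for p
      by (simp add: right_diff_distrib)
    then show ?case
      using closed_span_add[OF E Suc closed_span_scale[OF E step[of j], of "(1/3) ^ j"]]
      by presburger
  qed
  have small: "L2_sq (\<lambda>p. F 0 p - (F 0 p - (1/3) ^ j * F j p)) \<le> B * (1/3) ^ j" for j
  proof -
    have "L2_sq (\<lambda>p. F 0 p - (F 0 p - (1/3) ^ j * F j p)) = (cmod ((1/3) ^ j))\<^sup>2 * L2_sq (F j)"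
      by (simp only: diff_diff_eq2 add_diff_cancel_left' L2_sq_scale)
    also have "\<dots> \<le> (cmod ((1/3) ^ j))\<^sup>2 * (B * 3 ^ j)"
      by (intro mult_left_mono bound) simp
    also have "\<dots> = B * (1/3) ^ j"
      by (simp add: norm_power norm_divide power_divide power2_eq_square)
    finally show ?thesis .
  qed
  have lim: "(\<lambda>j. B * (1/3) ^ j) \<longlonglongrightarrow> 0"
    by (intro tendsto_mult_right_zero LIMSEQ_power_zero) simp
  fix e :: real assume "e > 0"
  then obtain j where "B * (1/3) ^ j < e"
    using eventually_happens'[OF sequentially_bot order_tendstoD(2)[OF lim]] by blast
  then show "\<exists>h\<in>closed_span E. L2_sq (\<lambda>p. F 0 p - h p) < e"
    using small[of j] by (intro bexI[OF _ tele[of j]]) (rule le_less_trans)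
qed


section \<open>Density of triadic step functions\<close>

lemma triadic_cell_small:
  assumes "\<lfloor>3 ^ m * x\<rfloor> = \<lfloor>3 ^ m * y\<rfloor>"
  shows "\<bar>x - y\<bar> < (1 / 3 ^ m :: real)"
proof -
  have "\<bar>3 ^ m * x - 3 ^ m * y\<bar> < 1"
    using assms by linarith
  then have "3 ^ m * \<bar>x - y\<bar> < 1"
    by (simp add: right_diff_distrib[symmetric] abs_mult)
  then show ?thesis
    by (simp add: field_simps)
qed

text \<open>One common scale for both coordinates makes any two squares nested or disjoint, hence a
  family stable under intersection.\<close>

definition triadic_square :: "nat \<Rightarrow> int \<Rightarrow> int \<Rightarrow> (real \<times> real) set" where
  "triadic_square m k l = {p. \<lfloor>3 ^ m * fst p\<rfloor> = k \<and> \<lfloor>3 ^ m * snd p\<rfloor> = l}"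

definition triadic_squares :: "(real \<times> real) set set" where
  "triadic_squares = insert {} (range (\<lambda>(m, k, l). triadic_square m k l))"

lemma triadic_squares_iff:
  "A \<in> triadic_squares \<longleftrightarrow> A = {} \<or> (\<exists>m k l. A = triadic_square m k l)"
  by (force simp: triadic_squares_def image_iff)

lemma countable_triadic_squares: "countable triadic_squares"
  by (auto simp: triadic_squares_def)

lemma indicator_triadic_square:
  "indicator (triadic_square m k l) p = triadic (int m) k (fst p) * triadic (int m) l (snd p)"
  by (auto simp: triadic_square_def triadic_def)

lemma triadic_square_Int:
  assumes "m \<le> m'"
  shows "triadic_square m k l \<inter> triadic_square m' k' l' =
    (if k' div 3 ^ (m' - m) = k \<and> l' div 3 ^ (m' - m) = l then triadic_square m' k' l' else {})"
proof -
  have "\<lfloor>3 ^ m * x\<rfloor> = \<lfloor>3 ^ m' * x\<rfloor> div 3 ^ (m' - m)" for x :: real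
    using floor_triadic_div[of "int m'" "m' - m" x] assms by (simp add: of_nat_diff)
  then show ?thesis
    by (auto simp: triadic_square_def)
qed

lemma Int_stable_triadic_squares: "Int_stable triadic_squares"
proof (rule Int_stableI)
  have *: "triadic_square m k l \<inter> triadic_square m' k' l' \<in> triadic_squares" if "m \<le> m'" for m m' k l k' l'
    unfolding triadic_square_Int[OF that] triadic_squares_iff by auto
  have "triadic_square m k l \<inter> triadic_square m' k' l' \<in> triadic_squares" for m m' k l k' l'
    using *[of m m' k l k' l'] *[of m' m k' l' k l] by (cases "m \<le> m'") (auto simp: Int_commute)
  then show "A \<inter> B \<in> triadic_squares" if "A \<in> triadic_squares" "B \<in> triadic_squares" for A B
    using that unfolding triadic_squares_iff[of A] triadic_squares_iff[of B]
    by (auto simp: triadic_squares_iff[of "{}"])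
qed

lemma open_Union_triadic_squares:
  assumes "open U"
  shows "U = \<Union>{Q \<in> triadic_squares. Q \<subseteq> U}"
proof (intro equalityI subsetI)
  fix p assume "p \<in> U"
  then obtain e where e: "e > 0" "\<And>q. dist q p < e \<Longrightarrow> q \<in> U"
    using assms by (auto simp: open_dist)
  \<comment> \<open>A cell has side \<open>1 / 3 ^ m\<close>, and the distance is at most the sum of
    the two coordinate distances, whence the 2.\<close>
  obtain m :: nat where m: "2 / e < 3 ^ m"
    using real_arch_pow[of 3 "2 / e"] by auto
  define Q where "Q = triadic_square m \<lfloor>3 ^ m * fst p\<rfloor> \<lfloor>3 ^ m * snd p\<rfloor>"
  have "Q \<subseteq> U"
  proof
    fix q assume "q \<in> Q"
    then have "\<bar>fst q - fst p\<bar> < 1 / 3 ^ m" "\<bar>snd q - snd p\<bar> < 1 / 3 ^ m"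
      by (auto simp: Q_def triadic_square_def intro!: triadic_cell_small)
    moreover have "dist q p \<le> \<bar>fst q - fst p\<bar> + \<bar>snd q - snd p\<bar>"
      unfolding dist_prod_def dist_real_def using sqrt_sum_squares_le_sum_abs by force
    ultimately have "dist q p < 2 / 3 ^ m" by simp
    also have "\<dots> < e" using m e(1) by (simp add: field_simps)
    finally show "q \<in> U" by (rule e(2))
  qed
  moreover have "Q \<in> triadic_squares" "p \<in> Q"
    by (auto simp: Q_def triadic_squares_iff triadic_square_def)
  ultimately show "p \<in> \<Union>{Q \<in> triadic_squares. Q \<subseteq> U}" by blast
qed auto

lemma borel_subset_sigma_triadic_squares: "sets borel \<subseteq> sigma_sets UNIV triadic_squares"
  unfolding sets_borel
proof (rule sigma_sets_mono, safe)
  fix U :: "(real \<times> real) set" assume "open U"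
  have "\<Union>{Q \<in> triadic_squares. Q \<subseteq> U} \<in> sigma_sets UNIV triadic_squares"
    by (rule sigma_sets_UNION) (auto intro: countable_subset[OF _ countable_triadic_squares])
  then show "U \<in> sigma_sets UNIV triadic_squares"
    using open_Union_triadic_squares[OF \<open>open U\<close>] by simp
qed

lemma triadic_squares_borel:
  assumes "A \<in> sigma_sets UNIV triadic_squares"
  shows "A \<in> sets borel"
proof -
  have "{p \<in> space (borel \<Otimes>\<^sub>M borel). \<lfloor>3 ^ m * fst p\<rfloor> = k \<and> \<lfloor>3 ^ m * snd p\<rfloor> = l}
      \<in> sets (borel \<Otimes>\<^sub>M borel :: (real \<times> real) measure)" for m :: nat and k l :: int
    by measurable
  then have "triadic_square m k l \<in> sets borel" for m k l
    by (simp add: triadic_square_def borel_prod[symmetric] space_pair_measure)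
  then have "triadic_squares \<subseteq> sets borel"
    by (auto simp: triadic_squares_iff)
  then show ?thesis
    using sets.sigma_sets_subset[of triadic_squares borel] assms by auto
qed

lemma triadic_tensor_L2: "(\<lambda>p. triadic m k (fst p) * triadic n l (snd p)) \<in> L2_plane"
proof -
  have "integrable lebesgue (\<lambda>p. Re (triadic m k (fst p) * triadic n l (snd p)))"
    by (rule integrable_Re[OF integrable_triadic])
  then show ?thesis
    by (rule L2_plane_dominated[OF triadic_tensor_measurable]) (simp add: triadic_def)
qed

lemma L2_sq_triadic_tensor:
  "L2_sq (\<lambda>p. triadic m k (fst p) * triadic n l (snd p)) = 3 powi (- m) * 3 powi (- n)"
proof -
  have "L2_sq (\<lambda>p. triadic m k (fst p) * triadic n l (snd p)) =
      (LINT p|lebesgue. Re (triadic m k (fst p) * triadic n l (snd p)))"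
    unfolding L2_sq_def by (intro Bochner_Integration.integral_cong) (auto simp: triadic_def)
  also have "\<dots> = Re (LINT p|lebesgue. triadic m k (fst p) * triadic n l (snd p))"
    by (rule integral_Re[OF integrable_triadic])
  finally show ?thesis
    by (simp only: integral_triadic Re_complex_of_real)
qed

text \<open>The argument climbs from triadic cells to Borel sets inside a unit square, then to Borel
  and Lebesgue sets with indicator in \<open>L2_plane\<close>, to simple functions, and to all of
  \<open>L2_plane\<close>.\<close>

lemma closed_span_eq_L2_plane:
  assumes E: "E \<subseteq> L2_plane"
    and cells: "\<And>m k n l. (\<lambda>p. triadic m k (fst p) * triadic n l (snd p)) \<in> closed_span E"
  shows "closed_span E = L2_plane"
proof -
  define unit where "unit k l p = triadic 0 k (fst p) * triadic 0 l (snd p)" for k l p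
  have unit_L2: "unit k l \<in> L2_plane" for k l
    unfolding unit_def[abs_def] by (rule triadic_tensor_L2)
  have unit_span: "unit k l \<in> closed_span E" for k l
    unfolding unit_def[abs_def] by (rule cells)
  \<comment> \<open>Cutting down to a unit square keeps measures finite, so complements and
    countable disjoint unions stay in the closed span.\<close>
  have local: "(\<lambda>p. indicator A p * unit k l p) \<in> closed_span E" if "A \<in> sets borel" for A k l
  proof -
    have "A \<in> sigma_sets UNIV triadic_squares"
      using that borel_subset_sigma_triadic_squares by blast
    \<comment> \<open>The second fact yields \<open>triadic_squares \<subseteq> Pow UNIV\<close>, as
      the induction rule requires.\<close>
    with Int_stable_triadic_squares Pow_UNIV[THEN equalityD2, THEN order_trans[OF top_greatest]] show ?thesis
    proof (induction A rule: sigma_sets_induct_disjoint)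
      case (basic A)
      then consider "A = {}" | m k' l' where "A = triadic_square m k' l'"
        by (auto simp: triadic_squares_iff)
      then show ?case
      proof cases
        case 1
        then show ?thesis by (simp add: closed_span_zero)
      next
        case 2
        have "indicator A p * unit k l p =
            of_bool (k' div 3 ^ m = k) * of_bool (l' div 3 ^ m = l) *
            (triadic (int m) k' (fst p) * triadic (int m) l' (snd p))" for p
        proof -
          have "indicator A p * unit k l p =
              (triadic 0 k (fst p) * triadic (int m) k' (fst p)) * (triadic 0 l (snd p) * triadic (int m) l' (snd p))"
            unfolding 2 indicator_triadic_square unit_def by (simp only: mult_ac)
          then show ?thesis by (simp only: triadic_mult[of 0 "int m"] of_nat_0_le_iff) simp
        qed
        then show ?thesis
          using closed_span_scale[OF E cells] by presburger
      qed
    next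
      case empty
      then show ?case by (simp add: closed_span_zero)
    next
      case (compl A)
      have "indicator (UNIV - A) p * unit k l p = unit k l p - indicator A p * unit k l p" for p
        by (simp add: indicator_def)
      then show ?case
        using closed_span_diff[OF E unit_span compl.IH] by presburger
    next
      case (union A)
      have "A i \<in> sets borel" for i
        using union.hyps(2) triadic_squares_borel by auto
      then have [measurable]: "(\<Union>i. A i) \<in> sets lebesgue"
        by (intro sets.countable_UN) auto
      note [measurable] = L2_plane_measurable[OF unit_L2]
      show ?case
      proof (rule closed_span_dominated[OF E, where s = "\<lambda>n p. \<Sum>i<n. indicator (A i) p * unit k l p"
            and w = "\<lambda>p. (cmod (unit k l p))\<^sup>2"])
        show "(\<lambda>p. \<Sum>i<n. indicator (A i) p * unit k l p) \<in> closed_span E" for n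
          by (intro closed_span_sum E union.IH)
        show "(\<lambda>p. indicator (\<Union>i. A i) p * unit k l p) \<in> borel_measurable lebesgue"
          by measurable
        show "integrable lebesgue (\<lambda>p. (cmod (unit k l p))\<^sup>2)"
          by (rule L2_plane_integrable[OF unit_L2])
        \<comment> \<open>Disjointness turns the partial sum into the indicator of a partial union,
          which the unit square dominates.\<close>
        have eq: "(\<Sum>i<n. indicator (A i) p * unit k l p) = indicator (\<Union>i<n. A i) p * unit k l p" for n p
          using union.hyps(1)
          by (subst indicator_UN_disjoint)
            (auto simp: sum_distrib_right disjoint_family_on_def)
        show "(\<lambda>n. \<Sum>i<n. indicator (A i) p * unit k l p) \<longlonglongrightarrow> indicator (\<Union>i. A i) p * unit k l p" for p
          unfolding eq by (intro tendsto_intros LIMSEQ_indicator_UN)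
        show "(cmod (\<Sum>i<n. indicator (A i) p * unit k l p))\<^sup>2 \<le> (cmod (unit k l p))\<^sup>2" for n p
          unfolding eq by (simp add: indicator_def)
      qed
    qed
  qed
  \<comment> \<open>Growing blocks of unit squares exhaust the plane; at each point the partial sums
    eventually equal the indicator.\<close>
  have borel_set: "indicator A \<in> closed_span E" if "A \<in> sets borel" "indicator A \<in> L2_plane" for A
  proof (rule closed_span_dominated[OF E,
        where s = "\<lambda>n p. \<Sum>k\<in>{-int n..<int n}. \<Sum>l\<in>{-int n..<int n}. indicator A p * unit k l p"
          and w = "\<lambda>p. (cmod (indicator A p))\<^sup>2"])
    show "(\<lambda>p. \<Sum>k\<in>{-int n..<int n}. \<Sum>l\<in>{-int n..<int n}. indicator A p * unit k l p) \<in> closed_span E" for n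
      by (intro closed_span_sum E local that)
    show "(indicator A :: _ \<Rightarrow> complex) \<in> borel_measurable lebesgue" "integrable lebesgue (\<lambda>p. (cmod (indicator A p))\<^sup>2)"
      using L2_planeD[OF that(2)] by auto
    have eq: "(\<Sum>k\<in>{-int n..<int n}. \<Sum>l\<in>{-int n..<int n}. indicator A p * unit k l p) =
        indicator A p * of_bool (\<lfloor>fst p\<rfloor> \<in> {-int n..<int n} \<and> \<lfloor>snd p\<rfloor> \<in> {-int n..<int n})" for n p
    proof -
      have one: "(\<Sum>k\<in>{-int n..<int n}. triadic 0 k x) = of_bool (\<lfloor>x\<rfloor> \<in> {-int n..<int n})" for x
        by (simp add: triadic_def of_bool_def)
      show ?thesis
        unfolding unit_def by (simp only: sum_distrib_left[symmetric] sum_distrib_right[symmetric] one) simp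
    qed
    show "(\<lambda>n. \<Sum>k\<in>{-int n..<int n}. \<Sum>l\<in>{-int n..<int n}. indicator A p * unit k l p) \<longlonglongrightarrow> indicator A p" for p
    proof (rule tendsto_eventually)
      show "eventually (\<lambda>n. (\<Sum>k\<in>{-int n..<int n}. \<Sum>l\<in>{-int n..<int n}. indicator A p * unit k l p) = indicator A p)
          sequentially"
        unfolding eq
        by (rule eventually_sequentiallyI[of "nat (\<bar>\<lfloor>fst p\<rfloor>\<bar> + \<bar>\<lfloor>snd p\<rfloor>\<bar> + 1)"]) auto
    qed
    show "(cmod (\<Sum>k\<in>{-int n..<int n}. \<Sum>l\<in>{-int n..<int n}. indicator A p * unit k l p))\<^sup>2
        \<le> (cmod (indicator A p))\<^sup>2" for n p
      unfolding eq by (simp add: indicator_def)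
  qed
  \<comment> \<open>A Lebesgue set differs from a Borel set only within a null set.\<close>
  have set: "indicator A \<in> closed_span E" if A: "A \<in> sets lebesgue" "indicator A \<in> L2_plane" for A
  proof -
    obtain S N N' where S: "A = S \<union> N" "N \<subseteq> N'" "N' \<in> null_sets lborel" "S \<in> sets lborel"
      using sets_completionE[OF A(1)] .
    have "AE p in lborel. p \<notin> N'" by (rule AE_not_in[OF S(3)])
    then have "AE p in lebesgue. p \<notin> N'" by (rule AE_completion)
    then have ae: "AE p in lebesgue. indicator A p = (indicator S p :: complex)"
      by (rule AE_mp) (use S(1,2) in \<open>auto intro!: AE_I2 simp: indicator_def\<close>)
    have Sm: "(indicator S :: _ \<Rightarrow> complex) \<in> borel_measurable lebesgue"
      using S(4) by (intro borel_measurable_lebesgueI) auto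
    have "indicator S \<in> closed_span E"
      using S(4) L2_plane_AE[OF A(2) Sm ae] by (intro borel_set) auto
    then show ?thesis
      by (rule closed_span_AE[OF E]) (use A(1) ae in \<open>auto simp: eq_commute\<close>)
  qed
  have simple: "g \<in> closed_span E" if "simple_function lebesgue g" and gL: "g \<in> L2_plane" for g
  proof -
    have fin: "finite (range g)" and lev: "\<And>y. g -` {y} \<in> sets lebesgue"
      using simple_functionD[OF that(1)] by auto
    have part: "(\<lambda>p. y * indicator (g -` {y}) p) \<in> closed_span E" for y
    proof (cases "y = 0")
      case False
      have "(\<lambda>p. y * indicator (g -` {y}) p) \<in> L2_plane"
      proof (rule L2_plane_dominated[OF _ L2_plane_integrable[OF gL]])
        show "(\<lambda>p. y * indicator (g -` {y}) p) \<in> borel_measurable lebesgue"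
          by (intro borel_measurable_times borel_measurable_const borel_measurable_indicator lev)
      qed (auto simp: indicator_def)
      from L2_plane_scale[OF this, of "1 / y"] False have "indicator (g -` {y}) \<in> L2_plane"
        by simp
      from closed_span_scale[OF E set[OF lev this]] show ?thesis .
    qed (simp add: closed_span_zero)
    have "(\<Sum>y\<in>range g. y * indicator (g -` {y}) p) = g p" for p
      using fin by (simp add: indicator_def if_distrib cong: if_cong)
    with closed_span_sum[OF E, of "range g" "\<lambda>y p. y * indicator (g -` {y}) p"] part
    show ?thesis by simp
  qed
  have "f \<in> closed_span E" if fL: "f \<in> L2_plane" for f
  proof -
    \<comment> \<open>With base point 0 the approximants are bounded by
      \<open>2 * cmod (f p)\<close>; squaring gives the dominating function with factor 4.\<close>
    obtain F where F: "\<And>i. simple_function lebesgue (F i)" "\<And>p. (\<lambda>i. F i p) \<longlonglongrightarrow> f p"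
      "\<And>i p. cmod (F i p) \<le> 2 * cmod (f p)"
      using borel_measurable_implies_sequence_metric[OF L2_plane_measurable[OF fL], of 0] by auto
    have w: "integrable lebesgue (\<lambda>p. 4 * (cmod (f p))\<^sup>2)"
      using L2_plane_integrable[OF fL] by simp
    have bound: "(cmod (F i p))\<^sup>2 \<le> 4 * (cmod (f p))\<^sup>2" for i p
      using power_mono[OF F(3)[of i p], of 2] by (simp add: power_mult_distrib)
    have "F i \<in> L2_plane" for i
      by (rule L2_plane_dominated[OF borel_measurable_simple_function[OF F(1)] w bound])
    then show ?thesis
      by (intro closed_span_dominated[OF E simple[OF F(1)] L2_plane_measurable[OF fL] w F(2) bound])
  qed
  then show ?thesis
    using closed_span_subset by auto
qed


section \<open>The coefficient matrices and the wavelets\<close>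

definition coef_scale :: "nat \<Rightarrow> real" where
  "coef_scale i = [sqrt 10 / 30, sqrt 15 / 30, sqrt 15 / 30, sqrt 10 / 10] ! i"

text \<open>Splitting off the square roots into \<open>coef_scale\<close> leaves integer matrices,
  whose identities can be checked by evaluation.\<close>

definition coef_matrix :: "nat \<Rightarrow> nat \<Rightarrow> nat \<Rightarrow> int" where
  "coef_matrix i a b =
     [[[5, -1, -4], [-4, -1, 5], [-1, 2, -1]],
      [[0, -1, 1], [-4, 4, 0], [4, -3, -1]],
      [[2, -5, 3], [0, 2, -2], [-2, 3, -1]],
      [[1, 0, -1], [0, 1, -1], [-1, -1, 2]]] ! i ! a ! b"

text \<open>The factor 3 is the normalisation of the wavelets: cells of area 1/9 call for
  coefficient matrices of squared norm 9.\<close>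

definition coef :: "nat \<Rightarrow> nat \<Rightarrow> nat \<Rightarrow> real" where
  "coef i a b = 3 * coef_scale i * of_int (coef_matrix i a b)"

definition psi :: "nat \<Rightarrow> real \<times> real \<Rightarrow> complex" where
  "psi i = [psi1, psi2, psi3, psi4] ! i"

lemma less_3_cases: "a < 3 \<Longrightarrow> a = 0 \<or> a = Suc 0 \<or> a = Suc (Suc 0)" for a :: nat
  by auto

lemma less_4_cases: "a < 4 \<Longrightarrow> a = 0 \<or> a = Suc 0 \<or> a = Suc (Suc 0) \<or> a = Suc (Suc (Suc 0))" for a :: nat
  by auto

lemma psi_eq_coef_sum:
  assumes "i < 4"
  shows "3 * psi i p = (\<Sum>a<3. \<Sum>b<3. of_real (coef i a b) * chi a b p)"
  using less_4_cases[OF assms]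
  by (elim disjE; simp add: psi_def psi1_def psi2_def psi3_def psi4_def coef_def coef_scale_def coef_matrix_def
      numeral_3_eq_3 numeral_2_eq_2 algebra_simps)

lemma coef_matrix_col_sum:
  assumes "i < 4" "b < 3"
  shows "(\<Sum>a<3. coef_matrix i a b) = 0"
  using less_4_cases[OF assms(1)] less_3_cases[OF assms(2)]
  by (elim disjE; simp add: coef_matrix_def numeral_3_eq_3)

lemma coef_matrix_row_sum:
  assumes "i < 4" "a < 3"
  shows "(\<Sum>b<3. coef_matrix i a b) = 0"
  using less_4_cases[OF assms(1)] less_3_cases[OF assms(2)]
  by (elim disjE; simp add: coef_matrix_def numeral_3_eq_3)

lemma coef_col_sum: "i < 4 \<Longrightarrow> b < 3 \<Longrightarrow> (\<Sum>a<3. coef i a b) = 0"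
  unfolding coef_def sum_distrib_left[symmetric] of_int_sum[symmetric] by (simp add: coef_matrix_col_sum)

lemma coef_row_sum: "i < 4 \<Longrightarrow> a < 3 \<Longrightarrow> (\<Sum>b<3. coef i a b) = 0"
  unfolding coef_def sum_distrib_left[symmetric] of_int_sum[symmetric] by (simp add: coef_matrix_row_sum)

lemma coef_scale_square: "i < 4 \<Longrightarrow> coef_scale i * coef_scale i = [1/90, 1/60, 1/60, 1/10] ! i"
  using less_4_cases by (fastforce simp: coef_scale_def)

text \<open>The integer matrices are pairwise orthogonal with squared norms 90, 60, 60, 10, the
  reciprocals of the squared scales. Thus the square roots survive only in products that
  vanish.\<close>

lemma coef_orthonormal:
  assumes "i < 4" "i' < 4"
  shows "(\<Sum>a<3. \<Sum>b<3. coef i a b * coef i' a b) = 9 * of_bool (i = i')"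
proof -
  have "(\<Sum>a<3. \<Sum>b<3. coef i a b * coef i' a b) =
      9 * (coef_scale i * coef_scale i') * of_int (\<Sum>a<3. \<Sum>b<3. coef_matrix i a b * coef_matrix i' a b)"
    by (simp add: coef_def sum_distrib_left mult_ac)
  also have "(\<Sum>a<3. \<Sum>b<3. coef_matrix i a b * coef_matrix i' a b) = (if i = i' then [90, 60, 60, 10] ! i else 0)"
    using less_4_cases[OF assms(1)] less_4_cases[OF assms(2)]
    by (elim disjE; simp add: coef_matrix_def numeral_3_eq_3)
  also have "9 * (coef_scale i * coef_scale i') * of_int (if i = i' then [90, 60, 60, 10] ! i else 0) = 9 * of_bool (i = i')"
    using less_4_cases[OF assms(1)] coef_scale_square[OF assms(1)] by auto
  finally show ?thesis .
qed

text \<open>The right-hand side is 9 times the matrix of the orthogonal projection onto the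
  \<open>3\<times>3\<close> matrices with vanishing row and column sums.\<close>

lemma coef_complete:
  assumes "a < 3" "b < 3" "a' < 3" "b' < 3"
  shows "(\<Sum>i<4. coef i a b * coef i a' b') = 9 * ((of_bool (a = a') - 1/3) * (of_bool (b = b') - 1/3))"
proof -
  \<comment> \<open>The weights 9/90, 9/60, 9/60, 9/10 over the common denominator 20 reduce the
    claim to an integer identity.\<close>
  have weight: "9 * (coef_scale i * coef_scale i) = of_int ([2, 3, 3, 18] ! i) / 20" if "i < 4" for i
    unfolding coef_scale_square[OF that] using less_4_cases[OF that] by auto
  have "(\<Sum>i<4. coef i a b * coef i a' b') =
      (\<Sum>i<4. 9 * (coef_scale i * coef_scale i) * of_int (coef_matrix i a b * coef_matrix i a' b'))"
    by (simp add: coef_def mult_ac)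
  also have "\<dots> = of_int (\<Sum>i<4. ([2, 3, 3, 18] ! i) * (coef_matrix i a b * coef_matrix i a' b')) / 20"
    by (simp add: weight sum_divide_distrib)
  also have "(\<Sum>i<4. ([2, 3, 3, 18] ! i) * (coef_matrix i a b * coef_matrix i a' b')) =
      20 * ((3 * of_bool (a = a') - 1) * (3 * of_bool (b = b') - 1))"
  proof -
    have "{..<4::nat} = {0, Suc 0, Suc (Suc 0), Suc (Suc (Suc 0))}"
      by auto
    then show ?thesis
      using less_3_cases[OF assms(1)] less_3_cases[OF assms(2)] less_3_cases[OF assms(3)] less_3_cases[OF assms(4)]
      by (elim disjE; simp add: coef_matrix_def)
  qed
  finally show ?thesis
    by (simp add: algebra_simps)
qed

section \<open>Wavelets on half-open triadic cells and their inner products\<close>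

definition wave :: "nat \<Rightarrow> int \<Rightarrow> int \<Rightarrow> int \<Rightarrow> int \<Rightarrow> real \<times> real \<Rightarrow> complex" where
  "wave i m n k l p = (\<Sum>a<3. \<Sum>b<3. of_real (coef i a b) *
     (triadic (m + 1) (3 * k + int a) (fst p) * triadic (n + 1) (3 * l + int b) (snd p)))"

lemma wave_L2: "wave i m n k l \<in> L2_plane"
  unfolding wave_def[abs_def] by (intro L2_plane_sum L2_plane_scale triadic_tensor_L2)

lemma cnj_wave: "cnj (wave i m n k l p) = wave i m n k l p"
  by (simp add: wave_def)

lemma L2_inner_wave_commute:
  "L2_inner (wave i m n k l) (wave i' m' n' k' l') = L2_inner (wave i' m' n' k' l') (wave i m n k l)"
  by (simp add: L2_inner_def cnj_wave mult.commute)

lemma L2_inner_wave: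
  "L2_inner (wave i m n k l) (wave i' m' n' k' l') = of_real
    (\<Sum>a<3. \<Sum>b<3. \<Sum>a'<3. \<Sum>b'<3. (coef i a b * coef i' a' b') *
      (triadic_inner (m + 1) (3 * k + int a) (m' + 1) (3 * k' + int a') *
       triadic_inner (n + 1) (3 * l + int b) (n' + 1) (3 * l' + int b')))"
proof -
  have "wave i m n k l p * cnj (wave i' m' n' k' l' p) =
     (\<Sum>a<3. \<Sum>b<3. \<Sum>a'<3. \<Sum>b'<3. of_real (coef i a b * coef i' a' b') *
       ((triadic (m + 1) (3 * k + int a) (fst p) * triadic (n + 1) (3 * l + int b) (snd p)) *
        (triadic (m' + 1) (3 * k' + int a') (fst p) * triadic (n' + 1) (3 * l' + int b') (snd p))))" for p
    unfolding cnj_wave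
    unfolding wave_def sum_distrib_right
    unfolding sum_distrib_left of_real_mult
    by (simp only: mult_ac)
  then show ?thesis
    unfolding L2_inner_def
    by (simp add: integral_sum integrable_sum integrable_triadic_tensor_mult integral_triadic_tensor_mult)
qed

text \<open>In a coordinate where the second wave is strictly finer, its three children meet each
  cell of the first wave equally, so the vanishing column or row sum factors out.\<close>

lemma L2_inner_wave_finer:
  assumes "m < m' \<or> n < n'" "i' < 4"
  shows "L2_inner (wave i m n k l) (wave i' m' n' k' l') = 0"
proof -
  have "(\<Sum>a'<3. \<Sum>b'<3. (coef i a b * coef i' a' b') *
      (triadic_inner (m + 1) (3 * k + int a) (m' + 1) (3 * k' + int a') *
       triadic_inner (n + 1) (3 * l + int b) (n' + 1) (3 * l' + int b'))) = 0" for a b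
    using assms(1)
  proof
    assume "m < m'"
    then have "(\<Sum>a'<3. (coef i a b * coef i' a' b') *
      (triadic_inner (m + 1) (3 * k + int a) (m' + 1) (3 * k' + int a') *
       triadic_inner (n + 1) (3 * l + int b) (n' + 1) (3 * l' + int b'))) =
      (\<Sum>a'<3. coef i' a' b') * (coef i a b * (triadic_inner (m + 1) (3 * k + int a) (m' + 1) (3 * k') *
       triadic_inner (n + 1) (3 * l + int b) (n' + 1) (3 * l' + int b')))" for b'
      unfolding sum_distrib_right by (intro sum.cong refl) (simp add: triadic_inner_finer)
    \<comment> \<open>The column sum runs over \<open>a'\<close>, which has to become the inner
      index.\<close>
    then show ?thesis
      using assms(2) by (subst sum.swap) (simp add: coef_col_sum)
  next
    assume "n < n'"
    then have "(\<Sum>b'<3. (coef i a b * coef i' a' b') *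
      (triadic_inner (m + 1) (3 * k + int a) (m' + 1) (3 * k' + int a') *
       triadic_inner (n + 1) (3 * l + int b) (n' + 1) (3 * l' + int b'))) =
      (\<Sum>b'<3. coef i' a' b') * (coef i a b * (triadic_inner (m + 1) (3 * k + int a) (m' + 1) (3 * k' + int a') *
       triadic_inner (n + 1) (3 * l + int b) (n' + 1) (3 * l')))" for a'
      unfolding sum_distrib_right by (intro sum.cong refl) (simp add: triadic_inner_finer)
    then show ?thesis
      using assms(2) by (simp add: coef_row_sum)
  qed
  then show ?thesis
    unfolding L2_inner_wave by simp
qed

lemma triadic_inner_siblings:
  assumes "a < 3" "a' < 3"
  shows "triadic_inner m (3 * k + int a) m (3 * k' + int a') = of_bool (k = k') * of_bool (a = a') * 3 powi (- m)"
proof -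
  have "3 * k + int a = 3 * k' + int a' \<longleftrightarrow> k = k' \<and> a = a'"
    using assms by presburger
  then show ?thesis by (simp add: triadic_inner_same)
qed

lemma L2_inner_wave_same_scale:
  assumes "i < 4" "i' < 4"
  shows "L2_inner (wave i m n k l) (wave i' m n k' l') =
    of_real (of_bool (i = i' \<and> k = k' \<and> l = l') * 3 powi (- (m + n)))"
proof -
  have "(\<Sum>a'<3. \<Sum>b'<3. (coef i a b * coef i' a' b') *
      (triadic_inner (m + 1) (3 * k + int a) (m + 1) (3 * k' + int a') *
       triadic_inner (n + 1) (3 * l + int b) (n + 1) (3 * l' + int b'))) =
      coef i a b * coef i' a b * (of_bool (k = k' \<and> l = l') * (3 powi (- (m + 1)) * 3 powi (- (n + 1))))"
    if "a < 3" "b < 3" for a b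
  proof -
    have "(\<Sum>a'<3. \<Sum>b'<3. (coef i a b * coef i' a' b') *
      (triadic_inner (m + 1) (3 * k + int a) (m + 1) (3 * k' + int a') *
       triadic_inner (n + 1) (3 * l + int b) (n + 1) (3 * l' + int b'))) =
      (\<Sum>a'<3. \<Sum>b'<3. if a = a' then if b = b' then
        coef i a b * coef i' a' b' * (of_bool (k = k' \<and> l = l') * (3 powi (- (m + 1)) * 3 powi (- (n + 1)))) else 0 else 0)"
      using that by (intro sum.cong refl) (auto simp: triadic_inner_siblings)
    also have "\<dots> = (\<Sum>a'<3. if a = a' then \<Sum>b'<3. if b = b' then
        coef i a b * coef i' a' b' * (of_bool (k = k' \<and> l = l') * (3 powi (- (m + 1)) * 3 powi (- (n + 1)))) else 0 else 0)"
      by (intro sum.cong refl) simp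
    also have "\<dots> = coef i a b * coef i' a b * (of_bool (k = k' \<and> l = l') * (3 powi (- (m + 1)) * 3 powi (- (n + 1))))"
      using that by simp
    finally show ?thesis .
  qed
  then have "L2_inner (wave i m n k l) (wave i' m n k' l') = of_real
      ((\<Sum>a<3. \<Sum>b<3. coef i a b * coef i' a b) * (of_bool (k = k' \<and> l = l') * (3 powi (- (m + 1)) * 3 powi (- (n + 1)))))"
    unfolding L2_inner_wave sum_distrib_right by (intro arg_cong[where f = of_real] sum.cong refl) simp
  also have "\<dots> = of_real (of_bool (i = i' \<and> k = k' \<and> l = l') * 3 powi (- (m + n)))"
  proof -
    \<comment> \<open>The squared norm 9 of the coefficients compensates for the children lying one
      scale finer in each coordinate.\<close>
    have "9 * (3 powi (- (m + 1)) * 3 powi (- (n + 1))) = (3 powi (- (m + n)) :: real)"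
      by (simp add: power_int_diff power_int_minus field_simps)
    then show ?thesis
      unfolding coef_orthonormal[OF assms] by (intro arg_cong[where f = of_real]) auto
  qed
  finally show ?thesis .
qed

lemma L2_inner_wave_eq:
  assumes "i < 4" "i' < 4"
  shows "L2_inner (wave i m n k l) (wave i' m' n' k' l') =
    of_real (of_bool (i = i' \<and> m = m' \<and> n = n' \<and> k = k' \<and> l = l') * 3 powi (- (m + n)))"
proof (cases "m = m' \<and> n = n'")
  case True
  then show ?thesis using L2_inner_wave_same_scale[OF assms] by simp
next
  case False
  \<comment> \<open>Different scale pairs make one of the waves strictly finer in some coordinate;
    symmetry reduces the second case to the first.\<close>
  then consider "m < m' \<or> n < n'" | "m' < m \<or> n' < n" by linarith
  then have "L2_inner (wave i m n k l) (wave i' m' n' k' l') = 0"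
  proof cases
    case 1
    then show ?thesis by (rule L2_inner_wave_finer) fact
  next
    case 2
    then show ?thesis
      by (subst L2_inner_wave_commute) (rule L2_inner_wave_finer[OF _ assms(1)])
  qed
  with False show ?thesis by auto
qed

section \<open>Details as combinations of waves, and recovery of cells by telescoping\<close>

definition triadic_detail :: "int \<Rightarrow> int \<Rightarrow> real \<Rightarrow> complex" where
  "triadic_detail m k x = triadic m k x - 1/3 * triadic (m - 1) (k div 3) x"

text \<open>Splitting the parent into its children shows that the coefficients are a row of the
  projection onto vectors of sum zero.\<close>

lemma triadic_detail_expand:
  assumes "a < 3"
  shows "triadic_detail (m + 1) (3 * k + int a) x =
    (\<Sum>a'<3. of_real (of_bool (a = a') - 1/3) * triadic (m + 1) (3 * k + int a') x)"
proof -
  have "(3 * k + int a) div 3 = k" using assms by auto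
  then have "triadic_detail (m + 1) (3 * k + int a) x =
      triadic (m + 1) (3 * k + int a) x - 1/3 * (\<Sum>a'<3. triadic (m + 1) (3 * k + int a') x)"
    by (simp add: triadic_detail_def triadic_refine[of m k])
  then show ?thesis
    using less_3_cases[OF assms] by (elim disjE; simp add: numeral_3_eq_3 algebra_simps)
qed

text \<open>This inverts the definition of \<open>wave\<close>: by \<open>coef_complete\<close>,
  summing over \<open>i\<close> leaves the product of the two one-dimensional projections.\<close>

lemma triadic_detail_tensor:
  assumes "a < 3" "b < 3"
  shows "triadic_detail (m + 1) (3 * k + int a) x * triadic_detail (n + 1) (3 * l + int b) y =
    (\<Sum>i<4. of_real (coef i a b / 9) * wave i m n k l (x, y))"
proof -
  have "(\<Sum>i<4. of_real (coef i a b / 9) * wave i m n k l (x, y)) =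
     (\<Sum>a'<3. \<Sum>b'<3. \<Sum>i<4. of_real (coef i a b / 9) * (of_real (coef i a' b') *
       (triadic (m + 1) (3 * k + int a') x * triadic (n + 1) (3 * l + int b') y)))"
    unfolding wave_def sum_distrib_left fst_conv snd_conv
    by (subst sum.swap) (intro sum.cong refl sum.swap)
  also have "\<dots> = (\<Sum>a'<3. \<Sum>b'<3. of_real ((\<Sum>i<4. coef i a b * coef i a' b') / 9) *
       (triadic (m + 1) (3 * k + int a') x * triadic (n + 1) (3 * l + int b') y))"
    by (simp add: sum_divide_distrib sum_distrib_right mult.assoc)
  also have "\<dots> = (\<Sum>a'<3. \<Sum>b'<3. (of_real (of_bool (a = a') - 1/3) * triadic (m + 1) (3 * k + int a') x) *
      (of_real (of_bool (b = b') - 1/3) * triadic (n + 1) (3 * l + int b') y))"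
    using assms by (intro sum.cong refl) (simp add: coef_complete del: of_real_diff)
  also have "\<dots> = triadic_detail (m + 1) (3 * k + int a) x * triadic_detail (n + 1) (3 * l + int b) y"
    using assms by (simp only: triadic_detail_expand sum_product)
  finally show ?thesis by simp
qed


lemma L2_inner_scale:
  "L2_inner (\<lambda>p. of_real c * f p) (\<lambda>p. of_real d * g p) = of_real (c * d) * L2_inner f g"
proof -
  have "of_real c * f p * cnj (of_real d * g p) = of_real (c * d) * (f p * cnj (g p))" for p
    by simp
  then show ?thesis
    unfolding L2_inner_def by (simp only: integral_mult_right_zero)
qed

text \<open>What matters in this crude bound is the factor \<open>3 powi (- m)\<close>: coarsening
  the first coordinate by \<open>j\<close> levels multiplies it by \<open>3 ^ j\<close>, the rate
  that \<open>closed_span_telescope\<close> permits.\<close>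

lemma triadic_detail_tensor_L2:
  "(\<lambda>p. triadic m k (fst p) * triadic_detail n l (snd p)) \<in> L2_plane"
  "L2_sq (\<lambda>p. triadic m k (fst p) * triadic_detail n l (snd p)) \<le>
     (2 * 3 powi (- n) + 2/9 * 3 powi (1 - n)) * 3 powi (- m)"
proof -
  have eq: "triadic m k (fst p) * triadic_detail n l (snd p) =
     triadic m k (fst p) * triadic n l (snd p) - 1/3 * (triadic m k (fst p) * triadic (n - 1) (l div 3) (snd p))"
    for p
    by (simp add: triadic_detail_def algebra_simps)
  show "(\<lambda>p. triadic m k (fst p) * triadic_detail n l (snd p)) \<in> L2_plane"
    unfolding eq by (intro L2_plane_diff L2_plane_scale triadic_tensor_L2)
  have "L2_sq (\<lambda>p. triadic m k (fst p) * triadic_detail n l (snd p)) \<le>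
      2 * L2_sq (\<lambda>p. triadic m k (fst p) * triadic n l (snd p)) +
      2 * L2_sq (\<lambda>p. 1/3 * (triadic m k (fst p) * triadic (n - 1) (l div 3) (snd p)))"
    unfolding eq by (intro L2_sq_diff_le L2_plane_scale triadic_tensor_L2)
  also have "\<dots> = (2 * 3 powi (- n) + 2/9 * 3 powi (1 - n)) * 3 powi (- m)"
    unfolding L2_sq_scale L2_sq_triadic_tensor
    by (simp add: norm_divide power_divide algebra_simps)
  finally show "L2_sq (\<lambda>p. triadic m k (fst p) * triadic_detail n l (snd p)) \<le>
     (2 * 3 powi (- n) + 2/9 * 3 powi (1 - n)) * 3 powi (- m)" .
qed

lemma power_int_minus_diff: "(3::real) powi (- (m - int j)) = 3 powi (- m) * 3 ^ j"
proof -
  have "- (m - int j) = - m + int j" by simp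
  moreover have "(3::real) powi (- m + int j) = 3 powi (- m) * 3 powi int j"
    by (rule power_int_add) simp
  ultimately show ?thesis by (simp only: power_int_of_nat)
qed

text \<open>The averages at ever coarser scales tend to 0 in norm, so each triadic cell is the limit of
  its detail parts, first in one coordinate and then in the other.\<close>

lemma triadic_tensor_in_closed_span:
  assumes E: "E \<subseteq> L2_plane"
    and waves: "\<And>i m n k l. i < 4 \<Longrightarrow> wave i m n k l \<in> closed_span E"
  shows "(\<lambda>p. triadic m k (fst p) * triadic n l (snd p)) \<in> closed_span E"
proof -
  have details: "(\<lambda>p. triadic_detail m k (fst p) * triadic_detail n l (snd p)) \<in> closed_span E" for m n k l
  proof -
    \<comment> \<open>These last ternary digits say which child of its parent each interval is. The
      waves live on the parents, hence at scales \<open>m - 1\<close> and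
      \<open>n - 1\<close>.\<close>
    define a where "a = nat (k mod 3)"
    define b where "b = nat (l mod 3)"
    have ab: "a < 3" "b < 3" "k = 3 * (k div 3) + int a" "l = 3 * (l div 3) + int b"
      by (auto simp: a_def b_def)
    have "triadic_detail m k (fst p) * triadic_detail n l (snd p) =
        (\<Sum>i<4. of_real (coef i a b / 9) * wave i (m - 1) (n - 1) (k div 3) (l div 3) p)" for p
      using triadic_detail_tensor[OF ab(1,2), of "m - 1" "k div 3" "fst p" "n - 1" "l div 3" "snd p"] ab(3,4)
      by simp
    moreover have "(\<lambda>p. \<Sum>i<4. of_real (coef i a b / 9) * wave i (m - 1) (n - 1) (k div 3) (l div 3) p) \<in> closed_span E"
      by (intro closed_span_sum closed_span_scale E waves) simp
    ultimately show ?thesis by presburger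
  qed
  have detail_step: "triadic (M - int j) (K div 3 ^ j) x - 1/3 * triadic (M - int (Suc j)) (K div 3 ^ Suc j) x =
      triadic_detail (M - int j) (K div 3 ^ j) x" for M K j x
  proof -
    have "K div 3 ^ j div 3 = K div 3 ^ Suc j"
      by (simp add: zdiv_zmult2_eq mult.commute[of 3])
    moreover have "M - int j - 1 = M - int (Suc j)" by simp
    ultimately show ?thesis by (simp only: triadic_detail_def)
  qed
  \<comment> \<open>Telescoping in the first coordinate, with the detail in the second held
    fixed.\<close>
  have half: "(\<lambda>p. triadic m k (fst p) * triadic_detail n l (snd p)) \<in> closed_span E" for m k n l
  proof -
    define F where "F j p = triadic (m - int j) (k div 3 ^ j) (fst p) * triadic_detail n l (snd p)" for j p
    have "F 0 \<in> closed_span E"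
    proof (rule closed_span_telescope[OF E])
      show "F j \<in> L2_plane" for j
        unfolding F_def[abs_def] by (rule triadic_detail_tensor_L2)
      show "(\<lambda>p. F j p - 1/3 * F (Suc j) p) \<in> closed_span E" for j
      proof -
        have "F j p - 1/3 * F (Suc j) p =
            (triadic (m - int j) (k div 3 ^ j) (fst p) - 1/3 * triadic (m - int (Suc j)) (k div 3 ^ Suc j) (fst p)) *
            triadic_detail n l (snd p)" for p
          unfolding F_def by (simp only: left_diff_distrib mult.assoc)
        then show ?thesis
          unfolding detail_step using details by presburger
      qed
      show "L2_sq (F j) \<le> ((2 * 3 powi (- n) + 2/9 * 3 powi (1 - n)) * 3 powi (- m)) * 3 ^ j" for j
        using triadic_detail_tensor_L2(2)[of "m - int j" "k div 3 ^ j" n l]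
        unfolding F_def[abs_def] power_int_minus_diff by (simp only: mult.assoc)
    qed
    then show ?thesis by (simp add: F_def[abs_def])
  qed
  \<comment> \<open>Telescoping in the second coordinate; each step is now an instance of
    \<open>half\<close>.\<close>
  define F where "F j p = triadic m k (fst p) * triadic (n - int j) (l div 3 ^ j) (snd p)" for j p
  have "F 0 \<in> closed_span E"
  proof (rule closed_span_telescope[OF E])
    show "F j \<in> L2_plane" for j
      unfolding F_def[abs_def] by (rule triadic_tensor_L2)
    show "(\<lambda>p. F j p - 1/3 * F (Suc j) p) \<in> closed_span E" for j
    proof -
      have "F j p - 1/3 * F (Suc j) p = triadic m k (fst p) *
          (triadic (n - int j) (l div 3 ^ j) (snd p) - 1/3 * triadic (n - int (Suc j)) (l div 3 ^ Suc j) (snd p))" for p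
        unfolding F_def by (simp only: right_diff_distrib mult_ac)
      then show ?thesis
        unfolding detail_step using half by presburger
    qed
    show "L2_sq (F j) \<le> (3 powi (- m) * 3 powi (- n)) * 3 ^ j" for j
      unfolding F_def[abs_def] L2_sq_triadic_tensor power_int_minus_diff by (simp only: mult.assoc order_refl)
  qed
  then show ?thesis by (simp add: F_def[abs_def])
qed

section \<open>Passage from the closed squares of the system to half-open cells\<close>

lemma irrational_cell:
  fixes x :: real
  assumes "x \<notin> \<rat>"
  shows "real a / 3 \<le> 3 powi m * x + of_int k \<and> 3 powi m * x + of_int k \<le> real (Suc a) / 3 \<longleftrightarrow>
    \<lfloor>3 powi (m + 1) * x\<rfloor> = 3 * (- k) + int a"
proof -
  have eq: "3 powi (m + 1) * x = 3 * (3 powi m * x)"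
    by (simp add: power_int_add)
  \<comment> \<open>Closed and half-open cells differ only at the right endpoint, which is rational;
    only the instance at that endpoint is used below.\<close>
  have "3 powi (m + 1) * x \<noteq> of_int j" for j
  proof
    assume "3 powi (m + 1) * x = of_int j"
    then have "x = of_int j / 3 powi (m + 1)"
      by (simp add: field_simps)
    moreover have "(3::real) powi i \<in> \<rat>" for i
      by (cases i rule: int_cases4) (auto simp: power_int_minus)
    ultimately show False using assms by auto
  qed
  from this[of "3 * (- k) + int a + 1"] show ?thesis
    unfolding eq floor_eq_iff by (auto simp: field_simps)
qed

text \<open>The exceptional points lie on countably many axis-parallel lines, each of measure
  zero.\<close>

lemma AE_irrational: "AE p :: real \<times> real in lebesgue. fst p \<notin> \<rat> \<and> snd p \<notin> \<rat>"
proof -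
  have "{p :: real \<times> real. p \<bullet> (1, 0) = q} \<in> null_sets lebesgue"
       "{p :: real \<times> real. p \<bullet> (0, 1) = q} \<in> null_sets lebesgue" for q
    unfolding negligible_iff_null_sets[symmetric]
    by (rule negligible_standard_hyperplane; simp add: Basis_prod_def)+
  then have "(\<Union>q\<in>\<rat>. {p :: real \<times> real. p \<bullet> (1, 0) = q}) \<in> null_sets lebesgue"
    "(\<Union>q\<in>\<rat>. {p :: real \<times> real. p \<bullet> (0, 1) = q}) \<in> null_sets lebesgue"
    by (intro null_sets_UN' countable_rat; simp)+
  from AE_not_in[OF this(1)] AE_not_in[OF this(2)] show ?thesis
    by eventually_elim (auto simp: inner_prod_def)
qed

definition system_elem :: "nat \<Rightarrow> int \<Rightarrow> int \<Rightarrow> int \<Rightarrow> int \<Rightarrow> real \<times> real \<Rightarrow> complex" where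
  "system_elem i m n k l p = of_real (3 powr (of_int (n + m) / 2)) *
     (3 * psi i (3 powi m * fst p + of_int k, 3 powi n * snd p + of_int l))"

lemma bidyadic_system_eq:
  "bidyadic_system {\<lambda>p. 3 * psi1 p, \<lambda>p. 3 * psi2 p, \<lambda>p. 3 * psi3 p, \<lambda>p. 3 * psi4 p} =
    {system_elem i m n k l | i m n k l. i < 4}"
proof -
  have four: "{..<4::nat} = {0, Suc 0, Suc (Suc 0), Suc (Suc (Suc 0))}" by auto
  have family: "{\<lambda>p. 3 * psi1 p, \<lambda>p. 3 * psi2 p, \<lambda>p. 3 * psi3 p, \<lambda>p. 3 * psi4 p} = (\<lambda>i p. 3 * psi i p) ` {..<4}"
    unfolding four by (simp add: psi_def)
  have reindex: "{F \<psi> m n k l | \<psi> m n k l. \<psi> \<in> h ` {..<4}} = {F (h i) m n k l | i m n k l. i < 4}"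
    for F :: "(real \<times> real \<Rightarrow> complex) \<Rightarrow> int \<Rightarrow> int \<Rightarrow> int \<Rightarrow> int \<Rightarrow> real \<times> real \<Rightarrow> complex" and h :: "nat \<Rightarrow> _"
    by blast
  show ?thesis
    unfolding bidyadic_system_def family reindex system_elem_def[abs_def] case_prod_unfold ..
qed

text \<open>Adding \<open>k\<close> to the argument moves the support to index \<open>- k\<close>,
  and its thirds are children one scale finer, hence \<open>m + 1\<close>.\<close>

lemma chi_affine:
  assumes "fst p \<notin> \<rat>" "snd p \<notin> \<rat>"
  shows "chi a b (3 powi m * fst p + of_int k, 3 powi n * snd p + of_int l) =
    triadic (m + 1) (3 * (- k) + int a) (fst p) * triadic (n + 1) (3 * (- l) + int b) (snd p)"
  using irrational_cell[OF assms(1), of a m k] irrational_cell[OF assms(2), of b n l]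
  unfolding chi_altdef by (auto simp: cbox_Pair_eq indicator_def triadic_def)

lemma system_elem_eq_wave:
  assumes "i < 4" "fst p \<notin> \<rat>" "snd p \<notin> \<rat>"
  shows "system_elem i m n k l p = of_real (3 powr (of_int (n + m) / 2)) * wave i m n (- k) (- l) p"
  unfolding system_elem_def psi_eq_coef_sum[OF assms(1)] chi_affine[OF assms(2,3)] wave_def ..

lemma system_elem_AE:
  assumes "i < 4"
  shows "AE p in lebesgue. system_elem i m n k l p = of_real (3 powr (of_int (n + m) / 2)) * wave i m n (- k) (- l) p"
  using AE_irrational by eventually_elim (simp add: system_elem_eq_wave[OF assms])

lemma system_elem_measurable:
  assumes "i < 4"
  shows "system_elem i m n k l \<in> borel_measurable lebesgue"
proof -
  have "chi a b \<in> borel_measurable borel" for a b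
    unfolding chi_altdef by (intro borel_measurable_indicator) auto
  then have "(\<lambda>p. chi a b (3 powi m * fst p + of_int k, 3 powi n * snd p + of_int l)) \<in> borel_measurable borel" for a b
    by (rule measurable_compose[rotated]) (intro borel_measurable_continuous_onI continuous_intros)
  then show ?thesis
    unfolding system_elem_def[abs_def] psi_eq_coef_sum[OF assms]
    by (intro borel_measurable_lebesgueI borel_measurable_times borel_measurable_sum borel_measurable_const)
qed

lemma system_elem_L2:
  assumes "i < 4"
  shows "system_elem i m n k l \<in> L2_plane"
  by (rule L2_plane_AE[OF L2_plane_scale[OF wave_L2] system_elem_measurable[OF assms]])
    (use system_elem_AE[OF assms] in \<open>simp only: eq_commute\<close>)

text \<open>The two factors \<open>3 powr (of_int (n + m) / 2)\<close> cancel the squared norm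
  \<open>3 powi (- (m + n))\<close> of a wave.\<close>

lemma L2_inner_system_elem:
  assumes "i < 4" "i' < 4"
  shows "L2_inner (system_elem i m n k l) (system_elem i' m' n' k' l') =
    of_bool (i = i' \<and> m = m' \<and> n = n' \<and> k = k' \<and> l = l')"
proof -
  have "L2_inner (system_elem i m n k l) (system_elem i' m' n' k' l') =
      L2_inner (\<lambda>p. of_real (3 powr (of_int (n + m) / 2)) * wave i m n (- k) (- l) p)
        (\<lambda>p. of_real (3 powr (of_int (n' + m') / 2)) * wave i' m' n' (- k') (- l') p)"
    by (intro L2_inner_AE system_elem_measurable system_elem_AE assms L2_plane_measurable L2_plane_scale wave_L2)
  also have "\<dots> = of_real (3 powr (of_int (n + m) / 2) * 3 powr (of_int (n' + m') / 2) *
      (of_bool (i = i' \<and> m = m' \<and> n = n' \<and> k = k' \<and> l = l') * 3 powi (- (m + n))))"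
    unfolding L2_inner_scale L2_inner_wave_eq[OF assms] by simp
  also have "\<dots> = of_bool (i = i' \<and> m = m' \<and> n = n' \<and> k = k' \<and> l = l')"
  proof -
    have "3 powr (of_int (n + m) / 2) * 3 powr (of_int (n + m) / 2) = (3::real) powr of_int (n + m)"
      by (simp add: powr_add[symmetric])
    also have "\<dots> = 3 powi (m + n)"
      using powr_real_of_int'[of 3 "n + m"] by (simp only: add.commute) simp
    finally have "3 powr (of_int (n + m) / 2) * 3 powr (of_int (n + m) / 2) * 3 powi (- (m + n)) = (1::real)"
      unfolding power_int_minus by simp
    then have "3 powr (of_int (n + m) / 2) * 3 powr (of_int (n' + m') / 2) *
        (of_bool (i = i' \<and> m = m' \<and> n = n' \<and> k = k' \<and> l = l') * 3 powi (- (m + n))) =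
        (of_bool (i = i' \<and> m = m' \<and> n = n' \<and> k = k' \<and> l = l') :: real)"
      by auto
    then show ?thesis by (simp only:) simp
  qed
  finally show ?thesis .
qed

theorem theorem4p3:
  "bidyadic_wavelet_set {\<lambda>p. 3 * psi1 p, \<lambda>p. 3 * psi2 p, \<lambda>p. 3 * psi3 p, \<lambda>p. 3 * psi4 p}"
proof -
  define E where "E = {system_elem i m n k l | i m n k l. i < 4}"
  have E: "E \<subseteq> L2_plane"
    by (auto simp: E_def system_elem_L2)
  have "wave i m n k l \<in> closed_span E" if "i < 4" for i m n k l
  proof -
    let ?c = "3 powr (of_int (n + m) / 2) :: real"
    \<comment> \<open>Undoing the normalisation and the sign of the translation recovers each wave,
      up to a null set, from one element of \<open>E\<close>.\<close>
    have "AE p in lebesgue. of_real (1 / ?c) * system_elem i m n (- k) (- l) p = wave i m n k l p"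
      using system_elem_AE[OF that, of m n "- k" "- l"] by eventually_elim simp
    moreover have "system_elem i m n (- k) (- l) \<in> E"
      unfolding E_def using that by blast
    ultimately show ?thesis
      by (intro closed_span_AE[OF E closed_span_scale[OF E closed_span_base[OF E]]] L2_plane_measurable wave_L2)
  qed
  then have dense: "closed_span E = L2_plane"
    by (intro closed_span_eq_L2_plane triadic_tensor_in_closed_span E)
  have "orthonormal_basis_L2 E"
    unfolding orthonormal_basis_L2_def
  proof (intro conjI ballI allI impI E)
    fix f g assume "f \<in> E" "g \<in> E"
    then obtain i m n k l i' m' n' k' l' where
      f: "f = system_elem i m n k l" "i < 4" and g: "g = system_elem i' m' n' k' l'" "i' < 4"
      unfolding E_def by blast
    \<comment> \<open>The goal compares functions, while \<open>L2_inner_system_elem\<close>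
      compares indices. Equal functions are covered here by using the index of \<open>f\<close>
      twice; distinct functions have distinct indices.\<close>
    have ff: "L2_inner f f = 1"
      unfolding f L2_inner_system_elem[OF f(2) f(2)] by simp
    show "L2_inner f g = (if f = g then 1 else 0)"
    proof (cases "f = g")
      case True
      with ff show ?thesis by simp
    next
      case False
      then show ?thesis
        using L2_inner_system_elem[OF f(2) g(2), of m n k l m' n' k' l'] unfolding f g by auto
    qed
  next
    fix f and e :: real assume "f \<in> L2_plane" "e > 0"
    then obtain T c where "finite T" "T \<subseteq> E" "L2_sq (\<lambda>p. f p - (\<Sum>g\<in>T. c g * g p)) < e\<^sup>2"
      using closed_spanD[of f E "e\<^sup>2"] dense by auto
    moreover from this(3) have "L2_norm (\<lambda>p. f p - (\<Sum>g\<in>T. c g * g p)) < e"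
      using \<open>e > 0\<close> unfolding L2_norm_def L2_sq_def by (intro real_less_lsqrt) simp_all
    ultimately show "\<exists>T c. finite T \<and> T \<subseteq> E \<and> L2_norm (\<lambda>p. f p - (\<Sum>g\<in>T. c g * g p)) < e"
      by blast
  qed
  then show ?thesis
    unfolding bidyadic_wavelet_set_def bidyadic_system_eq E_def .
qed

end
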